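(* Let $K$ be a field and let $E$ be a row-finite directed graph. Then there are order-isomorphisms $$\mathcal H\cong \mathcal L(M_E)\cong \mathcal L_{\mathrm{gr}}(L_K(E)),$$ where $\mathcal H$ is the lattice of hereditary and saturated subsets of $E^0$, $\mathcal L(M_E)$ is the lattice of order-ideals of the monoid $M_E$, and $\mathcal L_{\mathrm{gr}}(L_K(E))$ is the lattice of graded (two-sided) ideals of the graph algebra $L_K(E)$ (all ordered by inclusion).
   Context: A directed graph $E=(E^0,E^1)$ consists of a vertex set $E^0$, an edge set $E^1$, and maps $r,s\colon E^1\to E^0$ (range and source). A vertex $v$ emits edges if $s^{-1}(v)\neq\emptyset$. $E$ is row-finite if each vertex emits only finitely many edges. For $v,w\in E^0$ write $v\ge w$ if there is a (finite, possibly length-zero) directed path from $v$ to $w$. A subset $H\subseteq E^0$ is hereditary if $v\ge w$ and $v\in H$ imply $w\in H$. A hereditary set $H$ is saturated if $s^{-1}(v)\ne\emptyset$ and $r(s^{-1}(v))\subseteq H$ imply $v\in H$. $M_E$ is the abelian monoid with generators $\{a_v\mid v\in E^0\}$ and relations $a_v=\sum_{\{e\in E^1\mid s(e)=v\}}a_{r(e)}$ for every $v\in E^0$ that emits edges. An order-ideal of an abelian monoid $M$ is a submonoid $I$ such that $x+y\in I$ implies $x,y\in I$. The graph algebra $L_K(E)$ is the (not necessarily unital) $K$-algebra generated by a set $\{p_v\mid v\in E^0\}$ together with a set $\{x_e,y_e\mid e\in E^1\}$, subject to the relations: (1) $p_vp_{v'}=\delta_{v,v'}p_v$ for all $v,v'\in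 E^0$; (2) $p_{s(e)}x_e=x_ep_{r(e)}=x_e$ for all $e\in E^1$; (3) $p_{r(e)}y_e=y_ep_{s(e)}=y_e$ for all $e\in E^1$; (4) $y_ex_{e'}=\delta_{e,e'}p_{r(e)}$ for all $e,e'\in E^1$; (5) $p_v=\sum_{\{e\in E^1\mid s(e)=v\}}x_ey_e$ for every $v\in E^0$ that emits edges. It is $\mathbb Z$-graded, $L_K(E)=\bigoplus_{n\in\mathbb Z}L_K(E)_n$, by declaring each $p_v$ of degree $0$, each $x_e$ of degree $1$ and each $y_e$ of degree $-1$. An ideal $I$ of a $\mathbb Z$-graded ring $R=\bigoplus_n R_n$ is graded if $I=\bigoplus_{n\in\mathbb Z}(I\cap R_n)$. *)

theory Defs
  imports
    "HOL-Library.Multiset"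
    "HOL-Library.Poly_Mapping"
    "Graph_Theory.Digraph"
    "HOL-Algebra.QuotRing"
    "HOL-Algebra.Module"
begin

section \<open>Order isomorphisms between families of sets\<close>

definition inclusion_iso :: "'a set set \<Rightarrow> 'b set set \<Rightarrow> ('a set \<Rightarrow> 'b set) \<Rightarrow> bool" where
  "inclusion_iso \<A> \<B> f \<longleftrightarrow>
     bij_betw f \<A> \<B> \<and> (\<forall>X\<in>\<A>. \<forall>Y\<in>\<A>. X \<subseteq> Y \<longleftrightarrow> f X \<subseteq> f Y)"

section \<open>Directed graphs\<close>

text \<open>
  Graphs are the digraphs of \<^locale>\<open>wf_digraph\<close>: loops, parallel edges and infinite vertex and
  edge sets are allowed. The source map is \<^const>\<open>tail\<close>, the range map is \<^const>\<open>head\<close>, and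
  \<^term>\<open>out_arcs E v\<close> is the set of edges emitted by \<open>v\<close>.
\<close>

definition row_finite :: "('v, 'e) pre_digraph \<Rightarrow> bool" where
  "row_finite E \<longleftrightarrow> (\<forall>v\<in>verts E. finite (out_arcs E v))"

definition hereditary :: "('v, 'e) pre_digraph \<Rightarrow> 'v set \<Rightarrow> bool" where
  "hereditary E H \<longleftrightarrow>
     H \<subseteq> verts E \<and> (\<forall>v w. v \<rightarrow>\<^sup>*\<^bsub>E\<^esub> w \<and> v \<in> H \<longrightarrow> w \<in> H)"

definition saturated :: "('v, 'e) pre_digraph \<Rightarrow> 'v set \<Rightarrow> bool" where
  "saturated E H \<longleftrightarrow>
     (\<forall>v\<in>verts E. out_arcs E v \<noteq> {} \<and> head E ` out_arcs E v \<subseteq> H \<longrightarrow> v \<in> H)"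

definition hereditary_saturated_sets :: "('v, 'e) pre_digraph \<Rightarrow> 'v set set" where
  "hereditary_saturated_sets E = {H. hereditary E H \<and> saturated E H}"

section \<open>The graph monoid\<close>

text \<open>
  The free abelian monoid on the vertices consists of the finite multisets of vertices;
  \<open>graph_cong E\<close> is the least congruence on it containing the defining relations.
\<close>

inductive_set graph_cong :: "('v, 'e) pre_digraph \<Rightarrow> ('v multiset \<times> 'v multiset) set"
  for E :: "('v, 'e) pre_digraph" where
  relation: "v \<in> verts E \<Longrightarrow> out_arcs E v \<noteq> {} \<Longrightarrow>
     ({#v#}, \<Sum>e\<in>out_arcs E v. {#head E e#}) \<in> graph_cong E"
| refl: "set_mset x \<subseteq> verts E \<Longrightarrow> (x, x) \<in> graph_cong E"
| sym: "(x, y) \<in> graph_cong E \<Longrightarrow> (y, x) \<in> graph_cong E"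
| trans: "(x, y) \<in> graph_cong E \<Longrightarrow> (y, z) \<in> graph_cong E \<Longrightarrow> (x, z) \<in> graph_cong E"
| add: "(x, y) \<in> graph_cong E \<Longrightarrow> set_mset z \<subseteq> verts E \<Longrightarrow> (x + z, y + z) \<in> graph_cong E"

text \<open>The monoid is written multiplicatively, as is customary for \<^typ>\<open>'a monoid\<close>.\<close>

definition graph_monoid :: "('v, 'e) pre_digraph \<Rightarrow> 'v multiset set monoid" where
  "graph_monoid E =
     \<lparr>carrier = {x. set_mset x \<subseteq> verts E} // graph_cong E,
      mult = (\<lambda>X Y. \<Union>x\<in>X. \<Union>y\<in>Y. graph_cong E `` {x + y}),
      one = graph_cong E `` {{#}}\<rparr>"

definition order_ideal :: "'a set \<Rightarrow> ('a, 'm) monoid_scheme \<Rightarrow> bool" where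
  "order_ideal I M \<longleftrightarrow>
     submonoid I M \<and>
     (\<forall>x\<in>carrier M. \<forall>y\<in>carrier M. x \<otimes>\<^bsub>M\<^esub> y \<in> I \<longrightarrow> x \<in> I \<and> y \<in> I)"

definition order_ideals :: "('a, 'm) monoid_scheme \<Rightarrow> 'a set set" where
  "order_ideals M = {I. order_ideal I M}"

section \<open>Graded ideals of rings without unit\<close>

text \<open>
  The library locale \<^locale>\<open>ideal\<close> presupposes a unital ring. Below, rings are not required to
  have a unit and the field \<^const>\<open>one\<close> of the ring records is never used. Ideals of an algebra are its
  ideals as a ring; no closure under scalars is imposed.
\<close>

definition two_sided_ideal :: "'a set \<Rightarrow> ('a, 'm) ring_scheme \<Rightarrow> bool" where
  "two_sided_ideal I R \<longleftrightarrow>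
     additive_subgroup I R \<and>
     (\<forall>a\<in>I. \<forall>r\<in>carrier R. r \<otimes>\<^bsub>R\<^esub> a \<in> I \<and> a \<otimes>\<^bsub>R\<^esub> r \<in> I)"

definition finite_support_family ::
  "('a, 'm) ring_scheme \<Rightarrow> (int \<Rightarrow> 'a set) \<Rightarrow> (int \<Rightarrow> 'a) \<Rightarrow> bool" where
  "finite_support_family R V c \<longleftrightarrow> (\<forall>n. c n \<in> V n) \<and> finite {n. c n \<noteq> \<zero>\<^bsub>R\<^esub>}"

text \<open>\<open>A\<close> is the internal direct sum of the family \<open>V\<close> of additive subgroups of \<open>R\<close>.\<close>

definition is_direct_sum :: "('a, 'm) ring_scheme \<Rightarrow> 'a set \<Rightarrow> (int \<Rightarrow> 'a set) \<Rightarrow> bool" where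
  "is_direct_sum R A V \<longleftrightarrow>
     (\<forall>c. finite_support_family R V c \<longrightarrow> finsum R c {n. c n \<noteq> \<zero>\<^bsub>R\<^esub>} \<in> A) \<and>
     (\<forall>a\<in>A. \<exists>!c. finite_support_family R V c \<and> a = finsum R c {n. c n \<noteq> \<zero>\<^bsub>R\<^esub>})"

definition graded_ideals :: "('a, 'm) ring_scheme \<Rightarrow> (int \<Rightarrow> 'a set) \<Rightarrow> 'a set set" where
  "graded_ideals R V = {I. two_sided_ideal I R \<and> is_direct_sum R I (\<lambda>n. I \<inter> V n)}"

section \<open>The free algebra\<close>

datatype 'x free_word = Word (letters: "'x list")

instantiation free_word :: (type) monoid_add
begin

definition zero_free_word :: "'a free_word" where
  "0 = Word []"

definition plus_free_word :: "'a free_word \<Rightarrow> 'a free_word \<Rightarrow> 'a free_word" where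
  "u + w = Word (letters u @ letters w)"

instance
  by standard (simp_all add: zero_free_word_def plus_free_word_def)

end

text \<open>
  As words form a monoid, \<^typ>\<open>'x free_word \<Rightarrow>\<^sub>0 'k\<close> with its convolution product is the free unital
  \<open>'k\<close>-algebra on \<open>'x\<close>. The free non-unital algebra on a set \<open>S\<close> of letters consists of the
  linear combinations of nonempty words over \<open>S\<close>. Its \<^const>\<open>one\<close> field is a dummy.
\<close>

definition free_algebra ::
  "'x set \<Rightarrow> ('k::field, 'x free_word \<Rightarrow>\<^sub>0 'k) module" where
  "free_algebra S =
     \<lparr>carrier = {a. \<forall>w\<in>Poly_Mapping.keys a. letters w \<noteq> [] \<and> set (letters w) \<subseteq> S},
      mult = (*), one = 1, zero = 0, add = (+),
      smult = (\<lambda>k a. Poly_Mapping.single 0 k * a)\<rparr>"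

definition generator :: "'x \<Rightarrow> ('x free_word \<Rightarrow>\<^sub>0 'k::field)" where
  "generator x = Poly_Mapping.single (Word [x]) 1"

text \<open>
  Closure under scalars has to be demanded here: in an algebra without unit it does not follow from
  closure under multiplication by ring elements.
\<close>

definition generated_algebra_ideal :: "('k, 'a, 'm) module_scheme \<Rightarrow> 'a set \<Rightarrow> 'a set" where
  "generated_algebra_ideal A S =
     \<Inter>{I. two_sided_ideal I A \<and> (\<forall>k. \<forall>a\<in>I. k \<odot>\<^bsub>A\<^esub> a \<in> I) \<and> S \<subseteq> I}"

definition quotient_algebra :: "('k, 'a, 'm) module_scheme \<Rightarrow> 'a set \<Rightarrow> ('k, 'a set) module" where
  "quotient_algebra A J =
     ring.extend (A Quot J) (module.fields (\<lambda>k X. \<Union>a\<in>X. J +>\<^bsub>A\<^esub> (k \<odot>\<^bsub>A\<^esub> a)))"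

section \<open>The graph algebra\<close>

text \<open>
  The three kinds of letters stand for the generators \<open>p\<^sub>v\<close>, \<open>x\<^sub>e\<close> and \<open>y\<^sub>e\<close>.
\<close>

datatype ('v, 'e) letter = Vertex 'v | Edge 'e | Ghost 'e

definition graph_letters :: "('v, 'e) pre_digraph \<Rightarrow> ('v, 'e) letter set" where
  "graph_letters E = Vertex ` verts E \<union> Edge ` arcs E \<union> Ghost ` arcs E"

abbreviation gen_p :: "'v \<Rightarrow> (('v, 'e) letter free_word \<Rightarrow>\<^sub>0 'k::field)" where
  "gen_p v \<equiv> generator (Vertex v)"

abbreviation gen_x :: "'e \<Rightarrow> (('v, 'e) letter free_word \<Rightarrow>\<^sub>0 'k::field)" where
  "gen_x e \<equiv> generator (Edge e)"

abbreviation gen_y :: "'e \<Rightarrow> (('v, 'e) letter free_word \<Rightarrow>\<^sub>0 'k::field)" where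
  "gen_y e \<equiv> generator (Ghost e)"

definition graph_relators ::
  "('v, 'e) pre_digraph \<Rightarrow> (('v, 'e) letter free_word \<Rightarrow>\<^sub>0 'k::field) set" where
  "graph_relators E =
     {gen_p v * gen_p v' - (if v = v' then gen_p v else 0) | v v'. v \<in> verts E \<and> v' \<in> verts E} \<union>
     {gen_p (tail E e) * gen_x e - gen_x e | e. e \<in> arcs E} \<union>
     {gen_x e * gen_p (head E e) - gen_x e | e. e \<in> arcs E} \<union>
     {gen_p (head E e) * gen_y e - gen_y e | e. e \<in> arcs E} \<union>
     {gen_y e * gen_p (tail E e) - gen_y e | e. e \<in> arcs E} \<union>
     {gen_y e * gen_x e' - (if e = e' then gen_p (head E e) else 0) | e e'. e \<in> arcs E \<and> e' \<in> arcs E} \<union>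
     {gen_p v - (\<Sum>e\<in>out_arcs E v. gen_x e * gen_y e) | v. v \<in> verts E \<and> out_arcs E v \<noteq> {}}"

definition graph_ideal ::
  "('v, 'e) pre_digraph \<Rightarrow> (('v, 'e) letter free_word \<Rightarrow>\<^sub>0 'k::field) set" where
  "graph_ideal E = generated_algebra_ideal (free_algebra (graph_letters E)) (graph_relators E)"

definition graph_algebra ::
  "('v, 'e) pre_digraph \<Rightarrow> ('k::field, (('v, 'e) letter free_word \<Rightarrow>\<^sub>0 'k) set) module" where
  "graph_algebra E = quotient_algebra (free_algebra (graph_letters E)) (graph_ideal E)"

primrec letter_degree :: "('v, 'e) letter \<Rightarrow> int" where
  "letter_degree (Vertex v) = 0"
| "letter_degree (Edge e) = 1"
| "letter_degree (Ghost e) = - 1"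

definition word_degree :: "('v, 'e) letter free_word \<Rightarrow> int" where
  "word_degree w = (\<Sum>l\<leftarrow>letters w. letter_degree l)"

definition graph_algebra_component ::
  "('v, 'e) pre_digraph \<Rightarrow> int \<Rightarrow> (('v, 'e) letter free_word \<Rightarrow>\<^sub>0 'k::field) set set" where
  "graph_algebra_component E n =
     {graph_ideal E +>\<^bsub>free_algebra (graph_letters E)\<^esub> a | a.
        a \<in> carrier (free_algebra (graph_letters E)) \<and>
        (\<forall>w\<in>Poly_Mapping.keys a. word_degree w = n)}"

end

theory Submission
  imports Defs "HOL-Library.Countable_Set"
begin

text \<open>The three lattices are isomorphic because an order-ideal of the monoid and a graded ideal of the
algebra are both determined by the vertices they contain, and the sets of vertices that arise are
in both cases the hereditary saturated ones. For a vertex \<open>v\<close> that emits edges, the relation \<open>a\<^sub>v = \<Sum> a\<^bsub>r(e)\<^esub>\<close> on the one side, and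
\<open>p\<^bsub>r(e)\<^esub> = y\<^sub>e p\<^sub>v x\<^sub>e\<close> together with \<open>p\<^sub>v = \<Sum> x\<^sub>e p\<^bsub>r(e)\<^esub> y\<^sub>e\<close> on the other, say that \<open>v\<close> is contained exactly when
all heads of its edges are; this is heredity in one direction and saturation in the other.

For the monoid the rest is short. An order-ideal contains a sum exactly when it contains the
summands, so its generators determine it; conversely the defining congruence respects membership of all
vertices in a hereditary saturated set (\<open>graph_cong_hereditary_saturated\<close>), so every such set occurs.

For the algebra all computations are done in the free algebra. Ideals of the graph algebra are
ideals of the free algebra that contain the relators (\<open>free_quotient\<close>), and a coset is homogeneous of
degree \<open>n\<close> when it has such a representative. Two facts have to be proved.

First, the ideal generated by a hereditary saturated set \<open>H\<close> contains no further vertex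
(\<open>vertex_in_vertex_ideal_iff\<close>). This needs a representation of the graph algebra that kills \<open>H\<close>
and no other vertex. Give every vertex outside \<open>H\<close> a copy of the natural numbers. By
saturation, a vertex \<open>v \<notin> H\<close> that emits edges emits at least one, and by row-finiteness only finitely
many, with head outside \<open>H\<close>; hence the copy at \<open>v\<close> can be partitioned into one copy for each of these
edges. The letters then act on functions by pulling back along the resulting partial bijections.

Second, a graded ideal is generated by its vertices. This follows from a comparison
(\<open>graded_ideal_subset\<close>): if \<open>A\<close> and \<open>B\<close> contain the relators, \<open>A\<close> is graded, and every
vertex in \<open>A\<close> lies in \<open>B\<close>, then \<open>A \<subseteq> B\<close>. Modulo the relators, a homogeneous element is a
combination of words \<open>x\<^sub>\<alpha> p\<^sub>v y\<^sub>\<beta>\<close> with \<open>|\<alpha>| - |\<beta>|\<close> fixed. An element \<open>b\<close> of \<open>A\<close> is a finite sum of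
elements \<open>p\<^sub>v b\<close>. If \<open>v\<close> emits edges then \<open>p\<^sub>v b = \<Sum> x\<^sub>e (y\<^sub>e b)\<close>, and in \<open>y\<^sub>e b\<close> the bound on the
lengths of the \<open>\<alpha>\<close> is smaller; if \<open>v\<close> is a sink then all \<open>\<alpha>\<close> in \<open>p\<^sub>v b\<close> are empty. Induction reduces to the case where all
\<open>\<alpha>\<close> are empty (\<open>normal_combination_mem\<close>). Then, by homogeneity, all \<open>\<beta>\<close> have the same length, and
multiplying by edges from the right shortens them until only multiples of vertices are left
(\<open>ghost_combination_mem\<close>).\<close>

section \<open>Order isomorphisms\<close>

lemma inclusion_isoI:
  assumes "\<And>X. X \<in> \<A> \<Longrightarrow> f X \<in> \<B>" "\<And>Y. Y \<in> \<B> \<Longrightarrow> g Y \<in> \<A>"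
    and "\<And>X. X \<in> \<A> \<Longrightarrow> g (f X) = X" "\<And>Y. Y \<in> \<B> \<Longrightarrow> f (g Y) = Y"
    and "\<And>X X'. X \<in> \<A> \<Longrightarrow> X' \<in> \<A> \<Longrightarrow> X \<subseteq> X' \<Longrightarrow> f X \<subseteq> f X'"
    and "\<And>Y Y'. Y \<in> \<B> \<Longrightarrow> Y' \<in> \<B> \<Longrightarrow> Y \<subseteq> Y' \<Longrightarrow> g Y \<subseteq> g Y'"
  shows "inclusion_iso \<A> \<B> f"
proof -
  have "bij_betw f \<A> \<B>"
    by (rule bij_betw_byWitness[where f' = g]) (use assms in auto)
  moreover have "X \<subseteq> Y \<longleftrightarrow> f X \<subseteq> f Y" if "X \<in> \<A>" "Y \<in> \<A>" for X Y
    using assms(1,3)[OF that(1)] assms(1,3)[OF that(2)] assms(5)[OF that] assms(6)[of "f X" "f Y"]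
    by auto
  ultimately show ?thesis
    by (simp add: inclusion_iso_def)
qed

lemma inclusion_iso_inv_comp:
  assumes f: "inclusion_iso \<A> \<B> f" and h: "inclusion_iso \<A> \<C> h"
  shows "inclusion_iso \<B> \<C> (h \<circ> inv_into \<A> f)"
proof -
  have fb: "bij_betw f \<A> \<B>" and hb: "bij_betw h \<A> \<C>"
    using f h by (auto simp: inclusion_iso_def)
  have *: "inv_into \<A> f Y \<in> \<A> \<and> f (inv_into \<A> f Y) = Y" if "Y \<in> \<B>" for Y
    using that bij_betw_imp_surj_on[OF fb] by (auto simp: inv_into_into f_inv_into_f)
  show ?thesis
    using bij_betw_trans[OF bij_betw_inv_into[OF fb] hb] f h *
    unfolding inclusion_iso_def comp_def by metis
qed

section \<open>Order-ideals of the graph monoid\<close>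

abbreviation mset_class :: "('v, 'e) pre_digraph \<Rightarrow> 'v multiset \<Rightarrow> 'v multiset set" where
  "mset_class E x \<equiv> graph_cong E `` {x}"

definition vertex_order_ideal :: "('v, 'e) pre_digraph \<Rightarrow> 'v set \<Rightarrow> 'v multiset set set" where
  "vertex_order_ideal E H = mset_class E ` {x. set_mset x \<subseteq> H}"

definition order_ideal_vertices :: "('v, 'e) pre_digraph \<Rightarrow> 'v multiset set set \<Rightarrow> 'v set" where
  "order_ideal_vertices E I = {v \<in> verts E. mset_class E {#v#} \<in> I}"

lemma graph_cong_verts:
  assumes "wf_digraph E" and "(x, y) \<in> graph_cong E"
  shows "set_mset x \<subseteq> verts E \<and> set_mset y \<subseteq> verts E"
  using assms(2)
proof induction
  case (relation v)
  have "set_mset (\<Sum>e\<in>out_arcs E v. {#head E e#}) \<subseteq> verts E"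
    using wf_digraph.head_in_verts[OF assms(1)]
    by (cases "finite (out_arcs E v)") (auto simp: set_mset_sum)
  then show ?case using relation by simp
qed auto

lemma equiv_graph_cong:
  assumes "wf_digraph E"
  shows "equiv {x. set_mset x \<subseteq> verts E} (graph_cong E)"
  by (rule equivI)
     (use graph_cong_verts[OF assms] in \<open>auto simp: refl_on_def intro: graph_cong.refl symI transI
       graph_cong.sym graph_cong.trans\<close>)

lemma hereditary_head:
  assumes "wf_digraph E" "hereditary E H" "e \<in> arcs E" "tail E e \<in> H"
  shows "head E e \<in> H"
proof -
  have "tail E e \<rightarrow>\<^bsub>E\<^esub> head E e"
    using assms(3) by (rule arcs_ends_conv[THEN equalityD2, THEN subsetD, OF imageI, unfolded arc_to_ends_def])
  then have "tail E e \<rightarrow>\<^sup>*\<^bsub>E\<^esub> head E e"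
    using wf_digraph.reachable_adjI[OF assms(1)] by blast
  then show ?thesis using assms(2,4) unfolding hereditary_def by blast
qed

lemma hereditaryI:
  assumes "wf_digraph E" "H \<subseteq> verts E"
    and "\<And>e. e \<in> arcs E \<Longrightarrow> tail E e \<in> H \<Longrightarrow> head E e \<in> H"
  shows "hereditary E H"
proof -
  have "w \<in> H" if "v \<rightarrow>\<^sup>*\<^bsub>E\<^esub> w" "v \<in> H" for v w
    using that
  proof (induction rule: wf_digraph.reachable_induct[OF assms(1), consumes 1, case_names base step])
    case (step x y)
    then show ?case using assms(3) by (auto simp: arcs_ends_conv)
  qed
  then show ?thesis using assms(2) unfolding hereditary_def by blast
qed

text \<open>On a defining relation, heredity gives one implication and saturation the other. Row-finiteness
enters because a sum over infinitely many edges would be the empty multiset.\<close>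

lemma graph_cong_hereditary_saturated:
  assumes "wf_digraph E" "row_finite E" "hereditary E H" "saturated E H"
    and "(x, y) \<in> graph_cong E"
  shows "set_mset x \<subseteq> H \<longleftrightarrow> set_mset y \<subseteq> H"
  using assms(5)
proof induction
  case (relation v)
  have fin: "finite (out_arcs E v)"
    using assms(2) relation by (simp add: row_finite_def)
  have "head E e \<in> H" if "v \<in> H" "e \<in> out_arcs E v" for e
    using hereditary_head[OF assms(1,3)] that by auto
  moreover have "v \<in> H" if "head E ` out_arcs E v \<subseteq> H"
    using assms(4) relation that unfolding saturated_def by blast
  ultimately show ?case using fin by (auto simp: set_mset_sum)
qed auto

lemma graph_cong_add_both:
  assumes "wf_digraph E" and "(x, x') \<in> graph_cong E" "(y, y') \<in> graph_cong E"
  shows "(x + y, x' + y') \<in> graph_cong E"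
proof -
  have "(x + y, x' + y) \<in> graph_cong E"
    using graph_cong.add assms(2) graph_cong_verts[OF assms(1,3)] by blast
  moreover have "(x' + y, x' + y') \<in> graph_cong E"
    using graph_cong.add[OF assms(3), of x'] graph_cong_verts[OF assms(1,2)] by (simp add: add.commute)
  ultimately show ?thesis by (rule graph_cong.trans)
qed

lemma graph_monoid_mult:
  assumes "wf_digraph E" "set_mset x \<subseteq> verts E" "set_mset y \<subseteq> verts E"
  shows "mset_class E x \<otimes>\<^bsub>graph_monoid E\<^esub> mset_class E y = mset_class E (x + y)"
proof -
  have *: "mset_class E (x' + y') = mset_class E (x + y)" if "x' \<in> mset_class E x" "y' \<in> mset_class E y" for x' y'
    using that graph_cong_add_both[OF assms(1), of x x' y y'] equiv_class_eq[OF equiv_graph_cong[OF assms(1)]]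
    by fastforce
  have "(\<Union>x'\<in>mset_class E x. \<Union>y'\<in>mset_class E y. mset_class E (x' + y')) =
      (\<Union>x'\<in>mset_class E x. \<Union>y'\<in>mset_class E y. mset_class E (x + y))"
    by (intro SUP_cong * HOL.refl)
  also have "\<dots> = mset_class E (x + y)"
  proof -
    have "x \<in> mset_class E x" "y \<in> mset_class E y"
      using assms graph_cong.refl by auto
    then have "mset_class E x \<noteq> {}" "mset_class E y \<noteq> {}" by blast+
    then show ?thesis by (simp only: UN_constant if_False)
  qed
  finally show ?thesis
    by (simp only: graph_monoid_def monoid.simps)
qed

lemma graph_monoid_carrier: "carrier (graph_monoid E) = mset_class E ` {x. set_mset x \<subseteq> verts E}"
  by (auto simp: graph_monoid_def quotient_def)

lemma mset_class_eq_iff: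
  assumes "wf_digraph E" "set_mset x \<subseteq> verts E" "set_mset y \<subseteq> verts E"
  shows "mset_class E x = mset_class E y \<longleftrightarrow> (x, y) \<in> graph_cong E"
  using eq_equiv_class_iff[OF equiv_graph_cong[OF assms(1)]] assms by auto

text \<open>Since a congruence never crosses the boundary of a hereditary saturated set, membership of a
  class in the order-ideal can be read off from any representative.\<close>

lemma mset_class_in_vertex_order_ideal:
  assumes "wf_digraph E" "row_finite E" "H \<in> hereditary_saturated_sets E" "set_mset x \<subseteq> verts E"
  shows "mset_class E x \<in> vertex_order_ideal E H \<longleftrightarrow> set_mset x \<subseteq> H"
proof
  have H: "hereditary E H" "saturated E H" "H \<subseteq> verts E"
    using assms(3) by (auto simp: hereditary_saturated_sets_def hereditary_def)
  assume "mset_class E x \<in> vertex_order_ideal E H"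
  then obtain y where y: "set_mset y \<subseteq> H" "mset_class E x = mset_class E y"
    by (auto simp: vertex_order_ideal_def)
  then have "(x, y) \<in> graph_cong E"
    using mset_class_eq_iff[OF assms(1,4)] H(3) by blast
  then show "set_mset x \<subseteq> H"
    using graph_cong_hereditary_saturated[OF assms(1,2) H(1,2)] y(1) by blast
qed (auto simp: vertex_order_ideal_def)

lemma order_ideal_vertex_order_ideal:
  assumes "wf_digraph E" "row_finite E" "H \<in> hereditary_saturated_sets E"
  shows "order_ideal (vertex_order_ideal E H) (graph_monoid E)"
proof -
  let ?I = "vertex_order_ideal E H" and ?M = "graph_monoid E"
  have H: "H \<subseteq> verts E" using assms(3) by (auto simp: hereditary_saturated_sets_def hereditary_def)
  have "submonoid ?I ?M"
  proof
    show "?I \<subseteq> carrier ?M"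
      using H by (auto simp: vertex_order_ideal_def graph_monoid_carrier)
    show "\<one>\<^bsub>?M\<^esub> \<in> ?I"
      by (auto simp: graph_monoid_def vertex_order_ideal_def)
    fix X Y assume "X \<in> ?I" "Y \<in> ?I"
    then obtain x y where xy: "X = mset_class E x" "Y = mset_class E y" "set_mset x \<subseteq> H" "set_mset y \<subseteq> H"
      by (auto simp: vertex_order_ideal_def)
    have "set_mset x \<subseteq> verts E" "set_mset y \<subseteq> verts E"
      using xy(3,4) H by blast+
    then have "X \<otimes>\<^bsub>?M\<^esub> Y = mset_class E (x + y)"
      unfolding xy(1,2) by (rule graph_monoid_mult[OF assms(1)])
    then show "X \<otimes>\<^bsub>?M\<^esub> Y \<in> ?I"
      using xy by (auto simp: vertex_order_ideal_def)
  qed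
  moreover have "X \<in> ?I \<and> Y \<in> ?I"
    if XY: "X \<in> carrier ?M" "Y \<in> carrier ?M" "X \<otimes>\<^bsub>?M\<^esub> Y \<in> ?I" for X Y
  proof -
    from XY obtain x y where xy: "X = mset_class E x" "Y = mset_class E y"
        "set_mset x \<subseteq> verts E" "set_mset y \<subseteq> verts E"
      by (auto simp: graph_monoid_carrier)
    have "mset_class E (x + y) \<in> ?I"
      using XY(3) unfolding xy(1,2) graph_monoid_mult[OF assms(1) xy(3,4)] .
    then show ?thesis
      using xy mset_class_in_vertex_order_ideal[OF assms] by simp
  qed
  ultimately show ?thesis unfolding order_ideal_def by blast
qed

text \<open>An order-ideal contains a sum exactly when it contains both summands, so it is determined by the
generators in it.\<close>

lemma mset_class_in_order_ideal:
  assumes "wf_digraph E" "order_ideal I (graph_monoid E)" "set_mset x \<subseteq> verts E"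
  shows "mset_class E x \<in> I \<longleftrightarrow> set_mset x \<subseteq> order_ideal_vertices E I"
  using assms(3)
proof (induction x)
  case empty
  have "\<one>\<^bsub>graph_monoid E\<^esub> \<in> I"
    using assms(2) by (auto simp: order_ideal_def submonoid.one_closed)
  then show ?case by (simp add: graph_monoid_def)
next
  case (add v x)
  let ?M = "graph_monoid E"
  have sub: "submonoid I ?M" using assms(2) by (simp add: order_ideal_def)
  have prod: "mset_class E {#v#} \<otimes>\<^bsub>?M\<^esub> mset_class E x = mset_class E (add_mset v x)"
    using graph_monoid_mult[OF assms(1), of "{#v#}" x] add.prems by simp
  have carr: "mset_class E {#v#} \<in> carrier ?M" "mset_class E x \<in> carrier ?M"
    using add.prems by (auto simp: graph_monoid_carrier)
  have "mset_class E (add_mset v x) \<in> I \<longleftrightarrow> mset_class E {#v#} \<in> I \<and> mset_class E x \<in> I"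
    using assms(2) carr submonoid.m_closed[OF sub] unfolding order_ideal_def prod[symmetric] by blast
  then show ?case
    using add by (auto simp: order_ideal_vertices_def)
qed

text \<open>If \<open>v\<close> emits edges, its class is the sum of the classes of the heads, so \<open>v\<close> belongs to the set exactly when all
heads do.\<close>

lemma order_ideal_vertices_hereditary_saturated:
  assumes "wf_digraph E" "row_finite E" "order_ideal I (graph_monoid E)"
  shows "order_ideal_vertices E I \<in> hereditary_saturated_sets E"
proof -
  let ?H = "order_ideal_vertices E I"
  have key: "v \<in> ?H \<longleftrightarrow> head E ` out_arcs E v \<subseteq> ?H" if v: "v \<in> verts E" "out_arcs E v \<noteq> {}" for v
  proof -
    let ?s = "\<Sum>e\<in>out_arcs E v. {#head E e#}"
    have rel: "({#v#}, ?s) \<in> graph_cong E" using v by (rule graph_cong.relation)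
    have s: "set_mset ?s \<subseteq> verts E" using graph_cong_verts[OF assms(1) rel] by simp
    have "mset_class E {#v#} = mset_class E ?s"
      using rel equiv_class_eq[OF equiv_graph_cong[OF assms(1)]] by blast
    then have "v \<in> ?H \<longleftrightarrow> set_mset ?s \<subseteq> ?H"
      using mset_class_in_order_ideal[OF assms(1,3) s] v by (simp add: order_ideal_vertices_def)
    then show ?thesis
      using assms(2) v by (auto simp: set_mset_sum row_finite_def)
  qed
  have "hereditary E ?H"
  proof (rule hereditaryI[OF assms(1)])
    fix e assume e: "e \<in> arcs E" "tail E e \<in> ?H"
    then show "head E e \<in> ?H"
      using key[of "tail E e"] wf_digraph.tail_in_verts[OF assms(1) e(1)] by fastforce
  qed (auto simp: order_ideal_vertices_def)
  moreover have "saturated E ?H" using key by (auto simp: saturated_def)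
  ultimately show ?thesis by (simp add: hereditary_saturated_sets_def)
qed

lemma inclusion_iso_vertex_order_ideal:
  assumes "wf_digraph E" "row_finite E"
  shows "inclusion_iso (hereditary_saturated_sets E) (order_ideals (graph_monoid E)) (vertex_order_ideal E)"
proof (rule inclusion_isoI[where g = "order_ideal_vertices E"])
  show "vertex_order_ideal E H \<in> order_ideals (graph_monoid E)" if "H \<in> hereditary_saturated_sets E" for H
    using order_ideal_vertex_order_ideal[OF assms that] by (simp add: order_ideals_def)
  show "order_ideal_vertices E I \<in> hereditary_saturated_sets E" if "I \<in> order_ideals (graph_monoid E)" for I
    using order_ideal_vertices_hereditary_saturated[OF assms] that by (simp add: order_ideals_def)
  show "order_ideal_vertices E (vertex_order_ideal E H) = H" if H: "H \<in> hereditary_saturated_sets E" for H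
    using mset_class_in_vertex_order_ideal[OF assms H, of "{#v#}" for v] H
    by (auto simp: order_ideal_vertices_def hereditary_saturated_sets_def hereditary_def)
  show "vertex_order_ideal E (order_ideal_vertices E I) = I" if "I \<in> order_ideals (graph_monoid E)" for I
  proof -
    have I: "order_ideal I (graph_monoid E)" using that by (simp add: order_ideals_def)
    then have "I \<subseteq> mset_class E ` {x. set_mset x \<subseteq> verts E}"
      using submonoid.subset graph_monoid_carrier unfolding order_ideal_def by metis
    then have "I = mset_class E ` {x. set_mset x \<subseteq> verts E \<and> mset_class E x \<in> I}"
      by auto
    also have "{x. set_mset x \<subseteq> verts E \<and> mset_class E x \<in> I} =
        {x. set_mset x \<subseteq> order_ideal_vertices E I}"
      using mset_class_in_order_ideal[OF assms(1) I] by (auto simp: order_ideal_vertices_def)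
    finally show ?thesis unfolding vertex_order_ideal_def by (rule HOL.sym)
  qed
qed (auto simp: vertex_order_ideal_def order_ideal_vertices_def)

section \<open>Ideals of the free algebra\<close>

lemma keys_of_Diff: "Poly_Mapping.keys (a - b :: 'x \<Rightarrow>\<^sub>0 'k::ab_group_add) \<subseteq> Poly_Mapping.keys a \<union> Poly_Mapping.keys b"
  by (auto simp: in_keys_iff lookup_minus)

lemma sum_single_lookup:
  fixes a :: "'x \<Rightarrow>\<^sub>0 'k::comm_monoid_add"
  shows "(\<Sum>w\<in>Poly_Mapping.keys a. Poly_Mapping.single w (Poly_Mapping.lookup a w)) = a"
  by (rule poly_mapping_eqI)
     (auto simp: lookup_sum lookup_single when_def in_keys_iff sum.delta' if_distrib cong: if_cong)

lemma poly_mapping_span_induct [consumes 1, case_names zero single add]: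
  fixes a :: "'x \<Rightarrow>\<^sub>0 'k::comm_monoid_add"
  assumes "Poly_Mapping.keys a \<subseteq> T"
    and zero: "P 0"
    and single: "\<And>w c. w \<in> T \<Longrightarrow> P (Poly_Mapping.single w c)"
    and add: "\<And>a b. P a \<Longrightarrow> P b \<Longrightarrow> P (a + b)"
  shows "P a"
proof -
  have "P (\<Sum>w\<in>W. Poly_Mapping.single w (Poly_Mapping.lookup a w))"
    if "finite W" "W \<subseteq> Poly_Mapping.keys a" for W
    using that by (induction W rule: finite_induct) (use assms in auto)
  from this[of "Poly_Mapping.keys a"] show ?thesis
    by (simp add: sum_single_lookup)
qed

text \<open>The free unital algebra on \<open>S\<close>. Ideals of the free algebra without unit absorb products with
it, which makes the empty word and the scalars available as multipliers.\<close>

definition span_words :: "'x set \<Rightarrow> ('x free_word \<Rightarrow>\<^sub>0 'k::field) set" where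
  "span_words S = {a. \<forall>w\<in>Poly_Mapping.keys a. set (letters w) \<subseteq> S}"

abbreviation scalar :: "'k \<Rightarrow> 'x free_word \<Rightarrow>\<^sub>0 'k::field" where
  "scalar c \<equiv> Poly_Mapping.single 0 c"

abbreviation word_monomial :: "'x list \<Rightarrow> 'x free_word \<Rightarrow>\<^sub>0 'k::field" where
  "word_monomial xs \<equiv> Poly_Mapping.single (Word xs) 1"

lemma letters_plus [simp]: "letters (u + w) = letters u @ letters w"
  by (simp add: plus_free_word_def)

lemma letters_zero [simp]: "letters 0 = []"
  by (simp add: zero_free_word_def)

lemma Word_plus [simp]: "Word xs + Word ys = Word (xs @ ys)"
  by (simp add: plus_free_word_def)

lemma scalar_commute: "scalar c * a = a * scalar c" for a :: "'x free_word \<Rightarrow>\<^sub>0 'k::field"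
proof -
  have "Poly_Mapping.keys a \<subseteq> UNIV" by simp
  then show ?thesis
    by (induction rule: poly_mapping_span_induct) (auto simp: mult_single algebra_simps)
qed

lemma single_eq_scalar: "Poly_Mapping.single w c = scalar c * Poly_Mapping.single w 1"
  by (simp add: mult_single)

lemma word_monomial_Cons: "word_monomial (x # xs) = generator x * word_monomial xs"
  by (simp add: generator_def mult_single)

lemma word_monomial_snoc: "word_monomial (xs @ [x]) = word_monomial xs * generator x"
  by (simp add: generator_def mult_single)

lemma word_monomial_Nil: "word_monomial [] = 1"
  by (metis single_one zero_free_word_def)

lemma span_words_zero [simp, intro]: "0 \<in> span_words S"
  and span_words_one [simp, intro]: "1 \<in> span_words S"
  and span_words_scalar [simp, intro]: "scalar c \<in> span_words S"
  by (auto simp: span_words_def)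

lemma span_words_generator [simp, intro]: "x \<in> S \<Longrightarrow> generator x \<in> span_words S"
  by (auto simp: span_words_def generator_def)

lemma span_words_add [simp, intro]: "a \<in> span_words S \<Longrightarrow> b \<in> span_words S \<Longrightarrow> a + b \<in> span_words S"
  using keys_add[of a b] by (fastforce simp: span_words_def)

lemma span_words_mult [simp, intro]: "a \<in> span_words S \<Longrightarrow> b \<in> span_words S \<Longrightarrow> a * b \<in> span_words S"
  using keys_mult[of a b] by (fastforce simp: span_words_def)

lemma span_words_sum [simp, intro]: "(\<And>i. i \<in> F \<Longrightarrow> a i \<in> span_words S) \<Longrightarrow> sum a F \<in> span_words S"
  by (induction F rule: infinite_finite_induct) auto

abbreviation free_carrier :: "'x set \<Rightarrow> ('x free_word \<Rightarrow>\<^sub>0 'k::field) set" where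
  "free_carrier S \<equiv> carrier (free_algebra S)"

lemma free_carrier_eq: "free_carrier S = {a. \<forall>w\<in>Poly_Mapping.keys a. letters w \<noteq> [] \<and> set (letters w) \<subseteq> S}"
  by (simp add: free_algebra_def)

lemma free_carrier_keys:
  "a \<in> free_carrier S \<longleftrightarrow> Poly_Mapping.keys a \<subseteq> {w. letters w \<noteq> [] \<and> set (letters w) \<subseteq> S}"
  by (auto simp: free_carrier_eq)

lemma free_algebra_simps [simp]:
  "x \<otimes>\<^bsub>free_algebra S\<^esub> y = x * y" "x \<oplus>\<^bsub>free_algebra S\<^esub> y = x + y"
  "\<zero>\<^bsub>free_algebra S\<^esub> = 0" "k \<odot>\<^bsub>free_algebra S\<^esub> x = scalar k * x"
  by (simp_all add: free_algebra_def)

lemma free_carrier_span: "free_carrier S \<subseteq> span_words S"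
  by (auto simp: free_carrier_eq span_words_def)

lemma free_carrier_zero [simp, intro]: "0 \<in> free_carrier S"
  by (auto simp: free_carrier_eq)

lemma free_carrier_add [simp, intro]: "a \<in> free_carrier S \<Longrightarrow> b \<in> free_carrier S \<Longrightarrow> a + b \<in> free_carrier S"
  using keys_add[of a b] by (fastforce simp: free_carrier_eq)

lemma free_carrier_diff [simp, intro]: "a \<in> free_carrier S \<Longrightarrow> b \<in> free_carrier S \<Longrightarrow> a - b \<in> free_carrier S"
  using keys_of_Diff[of a b] by (fastforce simp: free_carrier_eq)

lemma free_carrier_uminus [simp, intro]: "a \<in> free_carrier S \<Longrightarrow> - a \<in> free_carrier S"
  by (simp add: free_carrier_eq)

lemma free_carrier_mult_left [simp, intro]: "a \<in> span_words S \<Longrightarrow> b \<in> free_carrier S \<Longrightarrow> a * b \<in> free_carrier S"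
  using keys_mult[of a b] by (fastforce simp: free_carrier_eq span_words_def)

lemma free_carrier_mult_right [simp, intro]: "a \<in> span_words S \<Longrightarrow> b \<in> free_carrier S \<Longrightarrow> b * a \<in> free_carrier S"
  using keys_mult[of b a] by (fastforce simp: free_carrier_eq span_words_def)

lemma free_carrier_generator [simp, intro]: "x \<in> S \<Longrightarrow> generator x \<in> free_carrier S"
  by (auto simp: free_carrier_eq generator_def)

lemma free_carrier_sum [simp, intro]: "(\<And>i. i \<in> F \<Longrightarrow> a i \<in> free_carrier S) \<Longrightarrow> sum a F \<in> free_carrier S"
  by (induction F rule: infinite_finite_induct) auto

lemma abelian_group_free_algebra: "abelian_group (free_algebra S)"
proof (rule abelian_groupI)
  fix x :: "'a free_word \<Rightarrow>\<^sub>0 'b" assume "x \<in> free_carrier S"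
  then show "\<exists>y\<in>free_carrier S. y \<oplus>\<^bsub>free_algebra S\<^esub> x = \<zero>\<^bsub>free_algebra S\<^esub>"
    by (intro bexI[of _ "- x"]) auto
qed (auto simp: add_ac)

lemma additive_subgroup_free_algebra_iff:
  "additive_subgroup I (free_algebra S) \<longleftrightarrow>
     I \<subseteq> free_carrier S \<and> 0 \<in> I \<and> (\<forall>a\<in>I. \<forall>b\<in>I. a - b \<in> I)" (is "?L \<longleftrightarrow> ?R")
proof
  interpret A: abelian_group "free_algebra S :: ('b, 'a free_word \<Rightarrow>\<^sub>0 'b) module"
    by (rule abelian_group_free_algebra)
  have inv: "\<ominus>\<^bsub>free_algebra S\<^esub> a = - a" if "a \<in> free_carrier S" for a :: "'a free_word \<Rightarrow>\<^sub>0 'b"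
    using A.minus_equality[of "- a" a] that by simp
  {
    assume ?L
    then interpret additive_subgroup I "free_algebra S" .
    have "a - b \<in> I" if "a \<in> I" "b \<in> I" for a b
      using a_closed[OF that(1) a_inv_closed[OF that(2)]] inv[of b] that a_subset by auto
    then show ?R using a_subset zero_closed by auto
  next
    assume R: ?R
    have m: "- b \<in> I" if "b \<in> I" for b using R that by (metis diff_0)
    have p: "a + b \<in> I" if "a \<in> I" "b \<in> I" for a b
      using R that(1) m[OF that(2)] by (metis diff_minus_eq_add)
    show ?L
    proof (rule additive_subgroup.intro, rule group.subgroupI)
      show "Group.group (add_monoid (free_algebra S :: ('b, 'a free_word \<Rightarrow>\<^sub>0 'b) module))"
        by (rule A.a_group)
      fix a assume "a \<in> I"
      then show "inv\<^bsub>add_monoid (free_algebra S)\<^esub> a \<in> I"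
        using inv[of a] m[of a] R by (auto simp: a_inv_def)
    qed (use R p in auto)
  }
qed

text \<open>The algebra ideals of the free algebra, with multiplication tested on the generators only: in
this form the property is easy to verify for kernels and for sets defined through
homogeneous components.\<close>

definition algebra_ideal :: "'x set \<Rightarrow> ('x free_word \<Rightarrow>\<^sub>0 'k::field) set \<Rightarrow> bool" where
  "algebra_ideal S I \<longleftrightarrow> I \<subseteq> free_carrier S \<and> 0 \<in> I \<and> (\<forall>a\<in>I. \<forall>b\<in>I. a + b \<in> I) \<and>
     (\<forall>c. \<forall>a\<in>I. scalar c * a \<in> I) \<and> (\<forall>x\<in>S. \<forall>a\<in>I. generator x * a \<in> I \<and> a * generator x \<in> I)"

lemma algebra_idealD:
  assumes "algebra_ideal S I"
  shows "I \<subseteq> free_carrier S" "0 \<in> I" "a \<in> I \<Longrightarrow> b \<in> I \<Longrightarrow> a + b \<in> I" "a \<in> I \<Longrightarrow> scalar c * a \<in> I"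
    "x \<in> S \<Longrightarrow> a \<in> I \<Longrightarrow> generator x * a \<in> I" "x \<in> S \<Longrightarrow> a \<in> I \<Longrightarrow> a * generator x \<in> I"
  using assms by (auto simp: algebra_ideal_def)

lemma algebra_ideal_uminus:
  assumes "algebra_ideal S I" "a \<in> I" shows "- a \<in> I"
proof -
  have "scalar (- 1) * a = - a"
    by (simp add: single_uminus)
  then show ?thesis using algebra_idealD(4)[OF assms, of "- 1"] by simp
qed

lemma algebra_ideal_diff: "algebra_ideal S I \<Longrightarrow> a \<in> I \<Longrightarrow> b \<in> I \<Longrightarrow> a - b \<in> I"
  using algebra_idealD(3)[of S I a "- b"] algebra_ideal_uminus[of S I b] by simp

lemma algebra_ideal_sum: "algebra_ideal S I \<Longrightarrow> (\<And>i. i \<in> F \<Longrightarrow> a i \<in> I) \<Longrightarrow> sum a F \<in> I"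
  by (induction F rule: infinite_finite_induct) (auto simp: algebra_idealD)

lemma algebra_ideal_mult:
  assumes I: "algebra_ideal S I" and r: "r \<in> span_words S"
  shows "a \<in> I \<Longrightarrow> r * a \<in> I" "a \<in> I \<Longrightarrow> a * r \<in> I"
proof -
  have mono: "word_monomial xs * a \<in> I \<and> a * word_monomial xs \<in> I" if "set xs \<subseteq> S" "a \<in> I" for xs a
    using that
  proof (induction xs arbitrary: a)
    case Nil
    then show ?case by (simp add: word_monomial_Nil)
  next
    case (Cons x xs)
    then show ?case
      using algebra_idealD(5,6)[OF I, of x] by (auto simp: word_monomial_Cons mult.assoc) (metis mult.assoc)
  qed
  have "Poly_Mapping.keys r \<subseteq> {w. set (letters w) \<subseteq> S}" using r by (auto simp: span_words_def)
  then have "\<forall>a\<in>I. r * a \<in> I \<and> a * r \<in> I"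
  proof (induction rule: poly_mapping_span_induct)
    case (single w c)
    have *: "Poly_Mapping.single w c = scalar c * word_monomial (letters w)"
      by (simp add: mult_single)
    show ?case
    proof
      fix a assume a: "a \<in> I"
      have 1: "scalar c * (word_monomial (letters w) * a) \<in> I" "scalar c * (a * word_monomial (letters w)) \<in> I"
        using mono[of "letters w" a] single a algebra_idealD(4)[OF I] by auto
      have "a * (scalar c * word_monomial (letters w)) = scalar c * (a * word_monomial (letters w))"
        by (simp add: mult.assoc[symmetric] scalar_commute[of c a])
      then show "Poly_Mapping.single w c * a \<in> I \<and> a * Poly_Mapping.single w c \<in> I"
        unfolding * using 1 by (simp add: mult.assoc)
    qed
  qed (use algebra_idealD[OF I] in \<open>auto simp: algebra_simps\<close>)
  then show "a \<in> I \<Longrightarrow> r * a \<in> I" "a \<in> I \<Longrightarrow> a * r \<in> I" by auto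
qed

lemma algebra_ideal_iff:
  "two_sided_ideal I (free_algebra S) \<and> (\<forall>k. \<forall>a\<in>I. k \<odot>\<^bsub>free_algebra S\<^esub> a \<in> I) \<longleftrightarrow> algebra_ideal S I"
  (is "?L \<longleftrightarrow> ?R")
proof
  assume L: ?L
  then have sub: "I \<subseteq> free_carrier S" and zero: "0 \<in> I" and diff: "\<forall>a\<in>I. \<forall>b\<in>I. a - b \<in> I"
    by (auto simp: two_sided_ideal_def additive_subgroup_free_algebra_iff)
  have "a + b \<in> I" if "a \<in> I" "b \<in> I" for a b
    using diff that zero by (metis diff_0 diff_minus_eq_add)
  then show ?R
    using L sub zero by (auto simp: algebra_ideal_def two_sided_ideal_def)
next
  assume R: ?R
  have "r * a \<in> I \<and> a * r \<in> I" if "a \<in> I" "r \<in> free_carrier S" for a r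
    using algebra_ideal_mult[OF R subsetD[OF free_carrier_span that(2)] that(1)] by simp
  then show ?L
    using algebra_idealD[OF R] algebra_ideal_diff[OF R]
    unfolding two_sided_ideal_def additive_subgroup_free_algebra_iff by simp
qed

abbreviation generated_ideal :: "'x set \<Rightarrow> ('x free_word \<Rightarrow>\<^sub>0 'k::field) set \<Rightarrow> ('x free_word \<Rightarrow>\<^sub>0 'k) set" where
  "generated_ideal S R \<equiv> generated_algebra_ideal (free_algebra S) R"

lemma generated_ideal_eq: "generated_ideal S R = \<Inter>{I. algebra_ideal S I \<and> R \<subseteq> I}"
proof -
  have "(two_sided_ideal I (free_algebra S) \<and> (\<forall>k. \<forall>a\<in>I. k \<odot>\<^bsub>free_algebra S\<^esub> a \<in> I) \<and> R \<subseteq> I) \<longleftrightarrow>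
      algebra_ideal S I \<and> R \<subseteq> I" for I
    using algebra_ideal_iff[of I S] by blast
  then show ?thesis unfolding generated_algebra_ideal_def by simp
qed

lemma algebra_ideal_free_carrier: "algebra_ideal S (free_carrier S)"
  by (auto simp: algebra_ideal_def)

lemma algebra_ideal_generated:
  assumes "R \<subseteq> free_carrier S"
  shows "algebra_ideal S (generated_ideal S R)"
proof -
  have "generated_ideal S R \<subseteq> free_carrier S"
    using assms algebra_ideal_free_carrier unfolding generated_ideal_eq by blast
  then show ?thesis
    unfolding algebra_ideal_def generated_ideal_eq by (simp add: algebra_idealD)
qed

lemma generated_ideal_superset: "R \<subseteq> generated_ideal S R"
  unfolding generated_ideal_eq by blast

lemma generated_ideal_least: "algebra_ideal S I \<Longrightarrow> R \<subseteq> I \<Longrightarrow> generated_ideal S R \<subseteq> I"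
  unfolding generated_ideal_eq by blast

section \<open>Computing modulo the defining relations\<close>

locale row_finite_graph = wf_digraph E for E :: "('v, 'e) pre_digraph" +
  assumes row_finite: "row_finite E"
begin

lemma graph_letters_simps [simp]:
  "Vertex v \<in> graph_letters E \<longleftrightarrow> v \<in> verts E"
  "Edge e \<in> graph_letters E \<longleftrightarrow> e \<in> arcs E"
  "Ghost e \<in> graph_letters E \<longleftrightarrow> e \<in> arcs E"
  by (auto simp: graph_letters_def)

lemma finite_out_arcs [simp]: "v \<in> verts E \<Longrightarrow> finite (out_arcs E v)"
  using row_finite by (simp add: row_finite_def)

text \<open>The vertex \<open>v\<close> for which the relations give \<open>p\<^sub>v l = l\<close>.\<close>

fun letter_source :: "('v, 'e) letter \<Rightarrow> 'v" where
  "letter_source (Vertex v) = v"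
| "letter_source (Edge e) = tail E e"
| "letter_source (Ghost e) = head E e"

lemma letter_source_in_verts [simp]: "l \<in> graph_letters E \<Longrightarrow> letter_source l \<in> verts E"
  by (cases l) auto

end

text \<open>Ideals of the graph algebra are represented by the ideals of the free algebra that contain the
relators. The relations of the graph algebra hold modulo each of them, so the calculations below
apply to the ideal of relations itself and to everything above it.\<close>

locale relator_ideal = row_finite_graph E for E :: "('v, 'e) pre_digraph" +
  fixes I :: "(('v, 'e) letter free_word \<Rightarrow>\<^sub>0 'k::field) set"
  assumes ideal: "algebra_ideal (graph_letters E) I"
    and relators: "graph_relators E \<subseteq> I"
begin

abbreviation "L \<equiv> graph_letters E"
abbreviation p :: "'v \<Rightarrow> ('v, 'e) letter free_word \<Rightarrow>\<^sub>0 'k" where "p v \<equiv> gen_p v"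
abbreviation x :: "'e \<Rightarrow> ('v, 'e) letter free_word \<Rightarrow>\<^sub>0 'k" where "x e \<equiv> gen_x e"
abbreviation y :: "'e \<Rightarrow> ('v, 'e) letter free_word \<Rightarrow>\<^sub>0 'k" where "y e \<equiv> gen_y e"

abbreviation wm :: "('v, 'e) letter list \<Rightarrow> ('v, 'e) letter free_word \<Rightarrow>\<^sub>0 'k" where
  "wm ls \<equiv> word_monomial ls"

definition cong :: "(('v, 'e) letter free_word \<Rightarrow>\<^sub>0 'k) \<Rightarrow> (('v, 'e) letter free_word \<Rightarrow>\<^sub>0 'k) \<Rightarrow> bool"
    (infix \<open>\<approx>\<close> 50) where
  "a \<approx> b \<longleftrightarrow> a - b \<in> I"

lemma cong_refl [simp]: "a \<approx> a"
  using algebra_idealD(2)[OF ideal] by (simp add: cong_def)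

lemma cong_sym: "a \<approx> b \<Longrightarrow> b \<approx> a"
  using algebra_ideal_uminus[OF ideal] by (fastforce simp: cong_def)

lemma cong_trans [trans]: "a \<approx> b \<Longrightarrow> b \<approx> c \<Longrightarrow> a \<approx> c"
  using algebra_idealD(3)[OF ideal, of "a - b" "b - c"] by (simp add: cong_def)

lemma cong_zero_iff: "a \<approx> 0 \<longleftrightarrow> a \<in> I"
  by (simp add: cong_def)

lemma cong_mem_iff: "a \<approx> b \<Longrightarrow> a \<in> I \<longleftrightarrow> b \<in> I"
  by (metis cong_sym cong_trans cong_zero_iff)

lemma cong_add: "a \<approx> b \<Longrightarrow> c \<approx> d \<Longrightarrow> a + c \<approx> b + d"
  using algebra_idealD(3)[OF ideal, of "a - b" "c - d"] by (simp add: cong_def algebra_simps)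

lemma cong_sum: "(\<And>i. i \<in> F \<Longrightarrow> a i \<approx> b i) \<Longrightarrow> sum a F \<approx> sum b F"
  by (induction F rule: infinite_finite_induct) (auto intro: cong_add)

lemma cong_mult_left: "r \<in> span_words L \<Longrightarrow> a \<approx> b \<Longrightarrow> r * a \<approx> r * b"
  using algebra_ideal_mult(1)[OF ideal, of r "a - b"] by (simp add: cong_def algebra_simps)

lemma cong_mult_right: "r \<in> span_words L \<Longrightarrow> a \<approx> b \<Longrightarrow> a * r \<approx> b * r"
  using algebra_ideal_mult(2)[OF ideal, of r "a - b"] by (simp add: cong_def algebra_simps)

lemma word_monomial_span [simp]: "set xs \<subseteq> L \<Longrightarrow> wm xs \<in> span_words L"
  by (auto simp: span_words_def)

lemma p_mult_p: "u \<in> verts E \<Longrightarrow> v \<in> verts E \<Longrightarrow> p u * p v \<approx> (if u = v then p u else 0)"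
  and p_mult_x: "e \<in> arcs E \<Longrightarrow> p (tail E e) * x e \<approx> x e"
  and x_mult_p: "e \<in> arcs E \<Longrightarrow> x e * p (head E e) \<approx> x e"
  and p_mult_y: "e \<in> arcs E \<Longrightarrow> p (head E e) * y e \<approx> y e"
  and y_mult_p: "e \<in> arcs E \<Longrightarrow> y e * p (tail E e) \<approx> y e"
  and y_mult_x: "e \<in> arcs E \<Longrightarrow> f \<in> arcs E \<Longrightarrow> y e * x f \<approx> (if e = f then p (head E e) else 0)"
  and p_eq_sum: "v \<in> verts E \<Longrightarrow> out_arcs E v \<noteq> {} \<Longrightarrow> p v \<approx> (\<Sum>e\<in>out_arcs E v. x e * y e)"
proof -
  have *: "a \<approx> b" if "a - b \<in> graph_relators E" for a b
    using relators that by (auto simp: cong_def)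
  show "u \<in> verts E \<Longrightarrow> v \<in> verts E \<Longrightarrow> p u * p v \<approx> (if u = v then p u else 0)"
    by (rule *, unfold graph_relators_def) blast
  show "e \<in> arcs E \<Longrightarrow> p (tail E e) * x e \<approx> x e"
    by (rule *, unfold graph_relators_def) blast
  show "e \<in> arcs E \<Longrightarrow> x e * p (head E e) \<approx> x e"
    by (rule *, unfold graph_relators_def) blast
  show "e \<in> arcs E \<Longrightarrow> p (head E e) * y e \<approx> y e"
    by (rule *, unfold graph_relators_def) blast
  show "e \<in> arcs E \<Longrightarrow> y e * p (tail E e) \<approx> y e"
    by (rule *, unfold graph_relators_def) blast
  show "e \<in> arcs E \<Longrightarrow> f \<in> arcs E \<Longrightarrow> y e * x f \<approx> (if e = f then p (head E e) else 0)"
    by (rule *, unfold graph_relators_def) blast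
  show "v \<in> verts E \<Longrightarrow> out_arcs E v \<noteq> {} \<Longrightarrow> p v \<approx> (\<Sum>e\<in>out_arcs E v. x e * y e)"
    by (rule *, unfold graph_relators_def) blast
qed

lemma p_mult_letter:
  assumes "u \<in> verts E" "l \<in> L"
  shows "p u * generator l \<approx> (if u = letter_source l then generator l else 0)"
proof -
  have s: "p (letter_source l) * generator l \<approx> generator l"
    using assms(2) p_mult_p[of "letter_source l" "letter_source l"] p_mult_x p_mult_y
    by (cases l) auto
  have "p u * generator l \<approx> p u * (p (letter_source l) * generator l)"
    using assms by (intro cong_mult_left cong_sym[OF s]) auto
  also have "\<dots> = (p u * p (letter_source l)) * generator l"
    by (simp add: mult.assoc)
  also have "\<dots> \<approx> (if u = letter_source l then p u else 0) * generator l"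
    using assms by (intro cong_mult_right p_mult_p) auto
  also have "\<dots> \<approx> (if u = letter_source l then generator l else 0)"
    using s by auto
  finally show ?thesis .
qed

lemma p_mult_word:
  assumes "u \<in> verts E" "set ls \<subseteq> L" "ls \<noteq> []"
  shows "p u * wm ls \<approx> (if u = letter_source (hd ls) then wm ls else 0)"
proof -
  obtain l ls' where ls: "ls = l # ls'" using assms(3) by (cases ls) auto
  have "p u * generator l * wm ls' \<approx>
      (if u = letter_source l then generator l else 0) * wm ls'"
    using assms ls by (intro cong_mult_right p_mult_letter) auto
  then show ?thesis unfolding ls by (simp add: word_monomial_Cons mult.assoc split: if_splits)
qed

text \<open>Statements about products are checked on words and extended linearly. The factors on both sides
cover multiplication from the left, from the right, and the bare statement that an element may be
rewritten.\<close>

lemma cong_linear_cases: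
  assumes "l \<in> span_words L" "r \<in> span_words L"
    and "\<And>w. w \<in> Poly_Mapping.keys b \<Longrightarrow>
      l * Poly_Mapping.single w 1 * r \<in> I \<or> (\<exists>w'\<in>T. l * Poly_Mapping.single w 1 * r \<approx> Poly_Mapping.single w' 1)"
  shows "\<exists>b'. Poly_Mapping.keys b' \<subseteq> T \<and> l * b * r \<approx> b'"
  using order_refl[of "Poly_Mapping.keys b"]
proof (induction rule: poly_mapping_span_induct)
  case zero
  show ?case by (rule exI[of _ 0]) simp
next
  case (single w c)
  have *: "l * Poly_Mapping.single w c * r = scalar c * (l * Poly_Mapping.single w 1 * r)"
    by (simp add: single_eq_scalar[of w c] mult.assoc[symmetric] scalar_commute[of c l])
  from assms(3)[OF single] show ?case
  proof
    assume "l * Poly_Mapping.single w 1 * r \<in> I"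
    then have "l * Poly_Mapping.single w c * r \<approx> 0"
      unfolding * cong_zero_iff by (rule algebra_idealD(4)[OF ideal])
    then show ?thesis by (intro exI[of _ 0]) simp
  next
    assume "\<exists>w'\<in>T. l * Poly_Mapping.single w 1 * r \<approx> Poly_Mapping.single w' 1"
    then obtain w' where w': "w' \<in> T" "l * Poly_Mapping.single w 1 * r \<approx> Poly_Mapping.single w' 1"
      by blast
    have "l * Poly_Mapping.single w c * r \<approx> Poly_Mapping.single w' c"
      unfolding * using cong_mult_left[OF span_words_scalar w'(2), of c] by (simp add: mult_single)
    then show ?thesis using w'(1) by (intro exI[of _ "Poly_Mapping.single w' c"]) simp
  qed
next
  case (add a b)
  then obtain a' b' where "Poly_Mapping.keys a' \<subseteq> T" "l * a * r \<approx> a'"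
      "Poly_Mapping.keys b' \<subseteq> T" "l * b * r \<approx> b'" by blast
  then show ?case
    using keys_add[of a' b'] cong_add[of "l * a * r" a' "l * b * r" b']
    by (intro exI[of _ "a' + b'"]) (auto simp: algebra_simps)
qed

lemma cong_linear_fixed:
  assumes "l \<in> span_words L" "r \<in> span_words L"
    and "\<And>w. w \<in> Poly_Mapping.keys b \<Longrightarrow> l * Poly_Mapping.single w 1 * r \<approx> Poly_Mapping.single w 1"
  shows "l * b * r \<approx> b"
  using order_refl[of "Poly_Mapping.keys b"]
proof (induction rule: poly_mapping_span_induct)
  case (single w c)
  have "l * Poly_Mapping.single w c * r = scalar c * (l * Poly_Mapping.single w 1 * r)"
    by (simp add: single_eq_scalar[of w c] mult.assoc[symmetric] scalar_commute[of c l])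
  also have "\<dots> \<approx> scalar c * Poly_Mapping.single w 1"
    by (intro cong_mult_left assms(3) single) auto
  finally show ?case by (simp add: mult_single)
qed (auto simp: algebra_simps intro: cong_add)

text \<open>The algebra need not have a unit, but each element has a left unit: the sum of the \<open>p\<^sub>v\<close> over the
sources \<open>v\<close> of the first letters of its words.\<close>

lemma local_unit:
  assumes b: "b \<in> free_carrier L"
  defines "V \<equiv> (\<lambda>w. letter_source (hd (letters w))) ` Poly_Mapping.keys b"
  shows "finite V" "V \<subseteq> verts E" "(\<Sum>v\<in>V. p v) * b \<approx> b"
proof -
  show fin: "finite V" by (simp add: V_def)
  show V: "V \<subseteq> verts E"
    using b hd_in_set by (fastforce simp: V_def free_carrier_eq)
  have "(\<Sum>v\<in>V. p v) * Poly_Mapping.single w 1 \<approx> Poly_Mapping.single w 1"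
    if w: "w \<in> Poly_Mapping.keys b" for w
  proof -
    obtain ls where ls: "w = Word ls" by (cases w)
    have "letters w \<noteq> [] \<and> set (letters w) \<subseteq> L" using b w unfolding free_carrier_eq by blast
    then have ls': "ls \<noteq> []" "set ls \<subseteq> L" using ls by auto
    have "(\<Sum>v\<in>V. p v) * wm ls = (\<Sum>v\<in>V. p v * wm ls)"
      by (simp add: sum_distrib_right)
    also have "\<dots> \<approx> (\<Sum>v\<in>V. if v = letter_source (hd ls) then wm ls else 0)"
      using V ls' by (intro cong_sum p_mult_word) auto
    also have "\<dots> = wm ls"
    proof -
      have "letter_source (hd ls) \<in> V" using w ls unfolding V_def by force
      then show ?thesis using fin by (simp add: sum.delta)
    qed
    finally show ?thesis by (simp add: ls)
  qed
  moreover have span: "(\<Sum>v\<in>V. p v) \<in> span_words L"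
    using V by (intro span_words_sum span_words_generator) (simp add: subset_iff)
  ultimately show "(\<Sum>v\<in>V. p v) * b \<approx> b"
    using cong_linear_fixed[OF span span_words_one, of b] by simp
qed

lemma mem_if_vertex_multiples_mem:
  assumes "b \<in> free_carrier L" and "\<And>v. v \<in> verts E \<Longrightarrow> p v * b \<in> I"
  shows "b \<in> I"
proof -
  let ?V = "(\<lambda>w. letter_source (hd (letters w))) ` Poly_Mapping.keys b"
  have "(\<Sum>v\<in>?V. p v * b) \<in> I"
    using local_unit(2)[OF assms(1)] assms(2) by (intro algebra_ideal_sum[OF ideal]) auto
  then show ?thesis
    using local_unit(3)[OF assms(1)] cong_mem_iff by (auto simp: sum_distrib_right)
qed

section \<open>Normal words\<close>

text \<open>These words represent \<open>x\<^sub>\<alpha> p\<^sub>v y\<^sub>\<beta>\<close>, where \<open>\<beta>\<close> lists the ghost edges from left to right. If \<open>\<alpha>\<close>,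
or \<open>\<beta>\<close> read backwards, is not a path that ends at \<open>v\<close>, the word vanishes modulo the relators.\<close>

definition normal_word :: "'e list \<Rightarrow> 'v \<Rightarrow> 'e list \<Rightarrow> ('v, 'e) letter list" where
  "normal_word \<alpha> v \<beta> = map Edge \<alpha> @ Vertex v # map Ghost \<beta>"

text \<open>In addition to the degree \<open>n\<close>, a bound on the length of \<open>\<alpha>\<close> is recorded; it is the measure for
the induction that compares ideals.\<close>

definition normal_words :: "int \<Rightarrow> nat \<Rightarrow> ('v, 'e) letter free_word set" where
  "normal_words n N = {Word (normal_word \<alpha> v \<beta>) | \<alpha> v \<beta>. set \<alpha> \<subseteq> arcs E \<and> v \<in> verts E \<and>
     set \<beta> \<subseteq> arcs E \<and> length \<alpha> \<le> N \<and> int (length \<alpha>) - int (length \<beta>) = n}"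

lemma normal_wordsI:
  "set \<alpha> \<subseteq> arcs E \<Longrightarrow> v \<in> verts E \<Longrightarrow> set \<beta> \<subseteq> arcs E \<Longrightarrow> length \<alpha> \<le> N \<Longrightarrow>
     int (length \<alpha>) - int (length \<beta>) = n \<Longrightarrow> Word (normal_word \<alpha> v \<beta>) \<in> normal_words n N"
  by (auto simp: normal_words_def)

lemma normal_wordsE:
  assumes "w \<in> normal_words n N"
  obtains \<alpha> v \<beta> where "w = Word (normal_word \<alpha> v \<beta>)" "set \<alpha> \<subseteq> arcs E" "v \<in> verts E"
    "set \<beta> \<subseteq> arcs E" "length \<alpha> \<le> N" "int (length \<alpha>) - int (length \<beta>) = n"
  using assms by (auto simp: normal_words_def)

lemma normal_words_mono: "N \<le> N' \<Longrightarrow> normal_words n N \<subseteq> normal_words n N'"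
  unfolding normal_words_def by fastforce

lemma set_normal_word:
  "set \<alpha> \<subseteq> arcs E \<Longrightarrow> v \<in> verts E \<Longrightarrow> set \<beta> \<subseteq> arcs E \<Longrightarrow> set (normal_word \<alpha> v \<beta>) \<subseteq> L"
  by (auto simp: normal_word_def)

lemma normal_word_not_Nil [simp]: "normal_word \<alpha> v \<beta> \<noteq> []"
  by (simp add: normal_word_def)

lemma normal_words_carrier:
  "Poly_Mapping.keys b \<subseteq> normal_words n N \<Longrightarrow> b \<in> free_carrier L"
  unfolding free_carrier_keys using set_normal_word by (fastforce elim!: normal_wordsE)

text \<open>Products of words and letters collapse, by the orthogonality relations, either to zero or to
a single word.\<close>

definition reduces_into :: "('v, 'e) letter free_word set \<Rightarrow> (('v, 'e) letter free_word \<Rightarrow>\<^sub>0 'k) \<Rightarrow> bool" where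
  "reduces_into T a \<longleftrightarrow> a \<in> I \<or> (\<exists>w\<in>T. a \<approx> Poly_Mapping.single w 1)"

lemma reduces_into_zero [simp]: "reduces_into T 0"
  using algebra_idealD(2)[OF ideal] by (simp add: reduces_into_def)

lemma reduces_into_single [simp]: "w \<in> T \<Longrightarrow> reduces_into T (Poly_Mapping.single w 1)"
  unfolding reduces_into_def by (blast intro: cong_refl)

lemma reduces_into_cong: "a \<approx> b \<Longrightarrow> reduces_into T b \<Longrightarrow> reduces_into T a"
  unfolding reduces_into_def using cong_mem_iff cong_trans by blast

lemma reduces_into_mono: "reduces_into T a \<Longrightarrow> T \<subseteq> T' \<Longrightarrow> reduces_into T' a"
  unfolding reduces_into_def by blast

lemma vertex_mult_normal:
  assumes "u \<in> verts E" "w \<in> normal_words n N"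
  shows "reduces_into (normal_words n N) (p u * Poly_Mapping.single w 1)"
  using assms(2)
proof (rule normal_wordsE)
  fix \<alpha> v \<beta> assume w: "w = Word (normal_word \<alpha> v \<beta>)" "set \<alpha> \<subseteq> arcs E" "v \<in> verts E" "set \<beta> \<subseteq> arcs E"
  show ?thesis
    by (rule reduces_into_cong, unfold w(1), rule p_mult_word[OF assms(1) set_normal_word[OF w(2-4)]])
       (use assms(2) w in auto)
qed

lemma edge_mult_normal:
  assumes "e \<in> arcs E" "w \<in> normal_words n N"
  shows "\<exists>w'\<in>normal_words (n + 1) (Suc N). x e * Poly_Mapping.single w 1 = Poly_Mapping.single w' 1"
  using assms(2)
proof (rule normal_wordsE)
  fix \<alpha> v \<beta> assume w: "w = Word (normal_word \<alpha> v \<beta>)" "set \<alpha> \<subseteq> arcs E" "v \<in> verts E" "set \<beta> \<subseteq> arcs E"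
     "length \<alpha> \<le> N" "int (length \<alpha>) - int (length \<beta>) = n"
  have "x e * Poly_Mapping.single w 1 = wm (normal_word (e # \<alpha>) v \<beta>)"
    by (simp add: w(1) word_monomial_Cons[symmetric] normal_word_def)
  moreover have "Word (normal_word (e # \<alpha>) v \<beta>) \<in> normal_words (n + 1) (Suc N)"
    using w assms(1) by (intro normal_wordsI) auto
  ultimately show ?thesis by blast
qed

text \<open>The ghost edge cancels the first edge if there is one and otherwise joins the ghost part. The
truncated difference \<open>N - 1\<close> accounts for both cases.\<close>

lemma ghost_mult_normal:
  assumes f: "f \<in> arcs E" and "w \<in> normal_words n N"
  shows "reduces_into (normal_words (n - 1) (N - 1)) (y f * Poly_Mapping.single w 1)"
  using assms(2)
proof (rule normal_wordsE)
  fix \<alpha> v \<beta> assume w: "w = Word (normal_word \<alpha> v \<beta>)" "set \<alpha> \<subseteq> arcs E" "v \<in> verts E" "set \<beta> \<subseteq> arcs E"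
     "length \<alpha> \<le> N" "int (length \<alpha>) - int (length \<beta>) = n"
  have gb: "wm (map Ghost \<beta>) \<in> span_words L"
    using w(4) by (intro word_monomial_span) auto
  show ?thesis
  proof (cases \<alpha>)
    case Nil
    have "y f * Poly_Mapping.single w 1 = y f * (p v * wm (map Ghost \<beta>))"
      by (simp add: w(1) Nil normal_word_def word_monomial_Cons)
    also have "\<dots> \<approx> (y f * p (tail E f)) * (p v * wm (map Ghost \<beta>))"
      by (rule cong_sym) (use f w(3) gb in \<open>intro cong_mult_right y_mult_p; auto\<close>)
    also have "\<dots> = y f * ((p (tail E f) * p v) * wm (map Ghost \<beta>))"
      by (simp add: mult.assoc)
    also have "\<dots> \<approx> y f * ((if tail E f = v then p (tail E f) else 0) * wm (map Ghost \<beta>))"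
      using f w(3) gb by (intro cong_mult_left cong_mult_right p_mult_p) auto
    finally have 1: "y f * Poly_Mapping.single w 1 \<approx> (if tail E f = v then y f * p (tail E f) * wm (map Ghost \<beta>) else 0)"
      by (simp add: mult.assoc split: if_splits)
    have 2: "y f * p (tail E f) * wm (map Ghost \<beta>) \<approx> wm (normal_word [] (head E f) (f # \<beta>))"
    proof -
      have "y f * p (tail E f) * wm (map Ghost \<beta>) \<approx> y f * wm (map Ghost \<beta>)"
        using f gb by (intro cong_mult_right y_mult_p) auto
      also have "\<dots> \<approx> (p (head E f) * y f) * wm (map Ghost \<beta>)"
        by (rule cong_sym) (use f gb in \<open>intro cong_mult_right p_mult_y; auto\<close>)
      finally show ?thesis
        by (simp add: normal_word_def word_monomial_Cons mult.assoc)
    qed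
    have 3: "Word (normal_word [] (head E f) (f # \<beta>)) \<in> normal_words (n - 1) (N - 1)"
      using f w Nil by (intro normal_wordsI) auto
    show ?thesis
      using reduces_into_cong[OF 2 reduces_into_single[OF 3]] by (intro reduces_into_cong[OF 1]) auto
  next
    case (Cons e \<alpha>')
    let ?m = "wm (normal_word \<alpha>' v \<beta>)"
    have m: "?m \<in> span_words L" using w Cons by (intro word_monomial_span set_normal_word) auto
    have "y f * Poly_Mapping.single w 1 = (y f * x e) * ?m"
      by (simp add: w(1) Cons normal_word_def word_monomial_Cons mult.assoc)
    also have "\<dots> \<approx> (if f = e then p (head E f) else 0) * ?m"
      using f w(2) Cons by (intro cong_mult_right m y_mult_x) auto
    finally have 1: "y f * Poly_Mapping.single w 1 \<approx> (if f = e then p (head E f) else 0) * ?m" .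
    have "Word (normal_word \<alpha>' v \<beta>) \<in> normal_words (n - 1) (N - 1)"
      using w Cons by (intro normal_wordsI) auto
    then have "reduces_into (normal_words (n - 1) (N - 1)) (p (head E f) * ?m)"
      using f by (intro vertex_mult_normal) auto
    then show ?thesis
      by (intro reduces_into_cong[OF 1]) auto
  qed
qed

text \<open>Multiplying a normal word by a letter from the left gives zero or a normal word again, so every
word can be normalized starting from its last letter.\<close>

lemma word_reduces_to_normal:
  assumes "set ls \<subseteq> L" "ls \<noteq> []"
  shows "reduces_into (\<Union>N. normal_words (word_degree (Word ls)) N) (wm ls)"
  using assms(2,1)
proof (induction ls rule: list_nonempty_induct)
  case (single l)
  have *: ?case if "generator l \<approx> wm (normal_word \<alpha> v \<beta>)" "set \<alpha> \<subseteq> arcs E" "v \<in> verts E"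
     "set \<beta> \<subseteq> arcs E" "int (length \<alpha>) - int (length \<beta>) = letter_degree l" for \<alpha> v \<beta>
  proof -
    have "Word (normal_word \<alpha> v \<beta>) \<in> normal_words (word_degree (Word [l])) (length \<alpha>)"
      using that by (intro normal_wordsI) (auto simp: word_degree_def)
    then show ?thesis
      using that(1) by (auto simp: reduces_into_def generator_def)
  qed
  show ?case
  proof (cases l)
    case (Vertex v)
    show ?thesis using single Vertex
      by (intro *[of "[]" v "[]"]) (auto simp: normal_word_def generator_def)
  next
    case (Edge e)
    show ?thesis using single Edge x_mult_p[of e, THEN cong_sym]
      by (intro *[of "[e]" "head E e" "[]"]) (auto simp: normal_word_def word_monomial_Cons word_monomial_Nil)
  next
    case (Ghost e)
    show ?thesis using single Ghost p_mult_y[of e, THEN cong_sym]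
      by (intro *[of "[]" "head E e" "[e]"]) (auto simp: normal_word_def word_monomial_Cons word_monomial_Nil)
  qed
next
  case (cons l ls)
  let ?n = "word_degree (Word ls)"
  have l: "l \<in> L" and ls: "set ls \<subseteq> L" using cons.prems by auto
  have deg: "word_degree (Word (l # ls)) = letter_degree l + ?n" by (simp add: word_degree_def)
  from cons.IH[OF ls] consider "wm ls \<in> I"
    | N w where "w \<in> normal_words ?n N" "wm ls \<approx> Poly_Mapping.single w 1"
    unfolding reduces_into_def by blast
  then show ?case
  proof cases
    case 1
    then show ?thesis using algebra_idealD(5)[OF ideal l] by (simp add: reduces_into_def word_monomial_Cons)
  next
    case (2 N w)
    have c: "wm (l # ls) \<approx> generator l * Poly_Mapping.single w 1"
      unfolding word_monomial_Cons using l by (intro cong_mult_left 2) auto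
    have "\<exists>N'. reduces_into (normal_words (letter_degree l + ?n) N') (generator l * Poly_Mapping.single w 1)"
    proof (cases l)
      case (Vertex u)
      then show ?thesis using vertex_mult_normal[OF _ 2(1), of u] l by auto
    next
      case (Edge e)
      then show ?thesis using edge_mult_normal[OF _ 2(1), of e] l
        by (auto simp: add.commute) (metis reduces_into_single)
    next
      case (Ghost e)
      then show ?thesis using ghost_mult_normal[OF _ 2(1), of e] l by auto
    qed
    then show ?thesis
      unfolding deg by (blast intro: reduces_into_cong[OF c] reduces_into_mono)
  qed
qed

end

context relator_ideal
begin

lemma normal_mult_vertex:
  assumes u: "u \<in> verts E" and "w \<in> normal_words n N"
  shows "reduces_into (normal_words n N) (Poly_Mapping.single w 1 * p u)"
  using assms(2)
proof (rule normal_wordsE)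
  fix \<alpha> v \<beta> assume w: "w = Word (normal_word \<alpha> v \<beta>)" "set \<alpha> \<subseteq> arcs E" "v \<in> verts E" "set \<beta> \<subseteq> arcs E"
  have *: "reduces_into (normal_words n N) (Poly_Mapping.single w 1 * p u)"
    if eq: "normal_word \<alpha> v \<beta> = ls @ [l]" "set ls \<subseteq> L" and
      lu: "generator l * p u \<approx> 0 \<or> generator l * p u \<approx> generator l" for ls l
  proof -
    have a: "Poly_Mapping.single w 1 * p u = wm ls * (generator l * p u)"
      by (simp add: w(1) eq word_monomial_snoc mult.assoc)
    have b: "wm ls * generator l = Poly_Mapping.single w 1"
      by (simp add: w(1) eq word_monomial_snoc)
    have "wm ls \<in> span_words L" using eq(2) by (rule word_monomial_span)
    with lu consider "wm ls * (generator l * p u) \<approx> wm ls * 0"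
      | "wm ls * (generator l * p u) \<approx> wm ls * generator l"
      by (blast intro: cong_mult_left)
    then show ?thesis
      by cases (use assms(2) a b in \<open>auto intro: reduces_into_cong\<close>)
  qed
  show ?thesis
  proof (cases \<beta> rule: rev_cases)
    case Nil
    have "p v * p u \<approx> 0 \<or> p v * p u \<approx> p v"
      using p_mult_p[OF w(3) u] by (simp split: if_splits)
    then show ?thesis
      using w by (intro *[of "map Edge \<alpha>" "Vertex v"]) (auto simp: normal_word_def Nil)
  next
    case (snoc \<beta>' h)
    have h: "h \<in> arcs E" using w(4) snoc by simp
    have "y h * p u \<approx> (y h * p (tail E h)) * p u"
      using u by (intro cong_mult_right cong_sym[OF y_mult_p[OF h]]) simp
    also have "\<dots> = y h * (p (tail E h) * p u)" by (simp add: mult.assoc)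
    also have "\<dots> \<approx> y h * (if tail E h = u then p (tail E h) else 0)"
      using h u by (intro cong_mult_left p_mult_p) auto
    finally have "y h * p u \<approx> 0 \<or> y h * p u \<approx> y h"
      using cong_trans[OF _ y_mult_p[OF h]] by (auto split: if_splits)
    then show ?thesis
      using w snoc by (intro *[of "normal_word \<alpha> v \<beta>'" "Ghost h"] set_normal_word)
        (auto simp: normal_word_def)
  qed
qed

lemma ghost_word_mult_edge:
  assumes f: "f \<in> arcs E" and g: "g \<in> arcs E" and v: "v \<in> verts E" and \<beta>: "set \<beta> \<subseteq> arcs E"
  shows "wm (normal_word [] v (\<beta> @ [g])) * x f \<approx>
      (if g = f then wm (normal_word [] v \<beta>) * p (head E f) else 0)"
proof -
  have "wm (normal_word [] v (\<beta> @ [g])) = wm (normal_word [] v \<beta>) * y g"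
    by (simp add: normal_word_def word_monomial_snoc[symmetric])
  then have "wm (normal_word [] v (\<beta> @ [g])) * x f = wm (normal_word [] v \<beta>) * (y g * x f)"
    by (simp add: mult.assoc)
  also have "\<dots> \<approx> wm (normal_word [] v \<beta>) * (if g = f then p (head E g) else 0)"
    using v \<beta> by (intro cong_mult_left y_mult_x f g word_monomial_span set_normal_word) auto
  finally show ?thesis by (simp split: if_splits)
qed

lemma ghost_wordsE:
  assumes "w \<in> normal_words (- int (Suc m)) 0"
  obtains v \<beta> g where "w = Word (normal_word [] v (\<beta> @ [g]))" "v \<in> verts E" "set \<beta> \<subseteq> arcs E"
    "g \<in> arcs E" "length \<beta> = m"
proof -
  obtain v \<beta> where w: "w = Word (normal_word [] v \<beta>)" "v \<in> verts E" "set \<beta> \<subseteq> arcs E" "length \<beta> = Suc m"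
    using assms by (auto elim!: normal_wordsE)
  then obtain \<beta>' g where "\<beta> = \<beta>' @ [g]" by (cases \<beta> rule: rev_cases) auto
  then show thesis using w that by auto
qed

lemma ghost_words_mult_edge:
  assumes f: "f \<in> arcs E" and w: "w \<in> normal_words (- int (Suc m)) 0"
  shows "reduces_into (normal_words (- int m) 0) (Poly_Mapping.single w 1 * x f)"
  using w
proof (rule ghost_wordsE)
  fix v \<beta> g assume w: "w = Word (normal_word [] v (\<beta> @ [g]))" "v \<in> verts E" "set \<beta> \<subseteq> arcs E"
    "g \<in> arcs E" "length \<beta> = m"
  have "reduces_into (normal_words (- int m) 0) (wm (normal_word [] v \<beta>) * p (head E f))"
    using f w by (intro normal_mult_vertex normal_wordsI) auto
  then show ?thesis
    unfolding w(1) by (intro reduces_into_cong[OF ghost_word_mult_edge[OF f w(4,2,3)]]) simp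
qed

text \<open>Among all \<open>x\<^sub>f y\<^sub>f\<close>, exactly the one that belongs to the last ghost edge acts as a unit from the right.\<close>

lemma ghost_word_mult_edge_ghost:
  assumes f: "f \<in> arcs E" and g: "g \<in> arcs E" and v: "v \<in> verts E" and \<beta>: "set \<beta> \<subseteq> arcs E"
  shows "wm (normal_word [] v (\<beta> @ [g])) * (x f * y f) \<approx>
      (if g = f then wm (normal_word [] v (\<beta> @ [g])) else 0)"
proof -
  have "wm (normal_word [] v (\<beta> @ [g])) * x f * y f \<approx>
      (if g = f then wm (normal_word [] v \<beta>) * p (head E f) else 0) * y f"
    using f by (intro cong_mult_right ghost_word_mult_edge assms) auto
  moreover have "wm (normal_word [] v \<beta>) * (p (head E f) * y f) \<approx> wm (normal_word [] v \<beta>) * y f"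
    using f v \<beta> by (intro cong_mult_left p_mult_y word_monomial_span set_normal_word) auto
  moreover have "wm (normal_word [] v (\<beta> @ [g])) = wm (normal_word [] v \<beta>) * y g"
    by (simp add: normal_word_def word_monomial_snoc[symmetric])
  ultimately show ?thesis
    by (auto simp: mult.assoc intro: cong_trans split: if_splits)
qed

text \<open>A word of negative degree without edges ends in a ghost edge. The sum of \<open>x\<^sub>f y\<^sub>f\<close> over the last
ghost edges that occur is therefore a right unit, even if some vertex emits further edges.\<close>

lemma ghost_combination_expand:
  assumes b: "Poly_Mapping.keys b \<subseteq> normal_words (- int (Suc m)) 0"
  obtains F where "finite F" "F \<subseteq> arcs E" "b * (\<Sum>f\<in>F. x f * y f) \<approx> b"
proof -
  define last_ghost :: "('v, 'e) letter free_word \<Rightarrow> 'e" where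
    "last_ghost w = (THE g. last (letters w) = Ghost g)" for w
  have last: "last_ghost (Word (normal_word [] v (\<beta> @ [g]))) = g" for v \<beta> g
    by (simp add: last_ghost_def normal_word_def)
  let ?F = "last_ghost ` Poly_Mapping.keys b"
  have F: "?F \<subseteq> arcs E"
    using b by (auto elim!: ghost_wordsE[OF subsetD[OF b]] simp: last)
  have "1 * Poly_Mapping.single w 1 * (\<Sum>f\<in>?F. x f * y f) \<approx> Poly_Mapping.single w 1"
    if w: "w \<in> Poly_Mapping.keys b" for w
  proof (rule ghost_wordsE[OF subsetD[OF b w]])
    fix v \<beta> g assume *: "w = Word (normal_word [] v (\<beta> @ [g]))" "v \<in> verts E" "set \<beta> \<subseteq> arcs E" "g \<in> arcs E"
    have g: "g \<in> ?F" using w last *(1) by (metis imageI)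
    have "Poly_Mapping.single w 1 * (\<Sum>f\<in>?F. x f * y f) =
        (\<Sum>f\<in>?F. wm (normal_word [] v (\<beta> @ [g])) * (x f * y f))"
      by (simp add: *(1) sum_distrib_left)
    also have "\<dots> \<approx> (\<Sum>f\<in>?F. if g = f then wm (normal_word [] v (\<beta> @ [g])) else 0)"
      using F * by (intro cong_sum ghost_word_mult_edge_ghost) auto
    also have "\<dots> = Poly_Mapping.single w 1"
      using g by (simp add: *(1))
    finally show ?thesis by simp
  qed
  moreover have "(\<Sum>f\<in>?F. x f * y f) \<in> span_words L"
    using F by (intro span_words_sum span_words_mult span_words_generator) auto
  ultimately have "b * (\<Sum>f\<in>?F. x f * y f) \<approx> b"
    using cong_linear_fixed[OF span_words_one, of "\<Sum>f\<in>?F. x f * y f" b] by simp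
  then show thesis using that[of ?F] F by simp
qed

section \<open>Comparing ideals through their vertices\<close>

lemma cong_mem_iff_superset: "algebra_ideal L A \<Longrightarrow> I \<subseteq> A \<Longrightarrow> a \<approx> b \<Longrightarrow> a \<in> A \<longleftrightarrow> b \<in> A"
  using algebra_idealD(3)[of L A "a - b" b] algebra_ideal_diff[of L A a "a - b"]
  by (auto simp: cong_def)

lemma relator_ideal_superset: "algebra_ideal L A \<Longrightarrow> I \<subseteq> A \<Longrightarrow> relator_ideal E A"
  using relators by unfold_locales auto

text \<open>All ghost parts have the same length \<open>m\<close>, and \<open>b = \<Sum> (b x\<^sub>f) y\<^sub>f\<close> with shorter ghost parts in \<open>b x\<^sub>f\<close>.
For \<open>m = 0\<close>, multiplication by \<open>p\<^sub>v\<close> isolates a scalar multiple of \<open>p\<^sub>v\<close> in \<open>A\<close>; over a field a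
nonzero multiple yields \<open>p\<^sub>v\<close> itself.\<close>

lemma ghost_combination_mem:
  assumes A: "algebra_ideal L A" "I \<subseteq> A" and B: "algebra_ideal L B" "I \<subseteq> B"
    and verts: "\<And>v. v \<in> verts E \<Longrightarrow> p v \<in> A \<Longrightarrow> p v \<in> B"
    and "Poly_Mapping.keys b \<subseteq> normal_words (- int m) 0" "b \<in> A"
  shows "b \<in> B"
  using assms(6,7)
proof (induction m arbitrary: b)
  case 0
  show ?case
  proof (rule relator_ideal.mem_if_vertex_multiples_mem[OF relator_ideal_superset[OF B]])
    show "b \<in> free_carrier L" using 0(1) by (rule normal_words_carrier)
    fix v assume v: "v \<in> verts E"
    have keys: "\<exists>u\<in>verts E. w = Word [Vertex u]" if "w \<in> Poly_Mapping.keys b" for w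
      using 0(1) that by (auto simp: normal_word_def elim!: normal_wordsE)
    have "p v * Poly_Mapping.single w 1 * 1 \<in> I \<or>
        (\<exists>w'\<in>{Word [Vertex v]}. p v * Poly_Mapping.single w 1 * 1 \<approx> Poly_Mapping.single w' 1)"
      if w: "w \<in> Poly_Mapping.keys b" for w
    proof -
      obtain u where "u \<in> verts E" "Poly_Mapping.single w 1 = p u"
        using keys[OF w] by (auto simp: generator_def)
      then show ?thesis
        using p_mult_p[OF v, of u] by (auto simp: cong_zero_iff generator_def split: if_splits)
    qed
    then obtain b' where b': "Poly_Mapping.keys b' \<subseteq> {Word [Vertex v]}" "p v * b \<approx> b'"
      using cong_linear_cases[of "p v" 1 b "{Word [Vertex v]}"] v by auto
    have "p v * b \<in> A" using algebra_idealD(5)[OF A(1)] v 0(2) by simp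
    then have b'A: "b' \<in> A" using cong_mem_iff_superset[OF A b'(2)] by simp
    define c where "c = Poly_Mapping.lookup b' (Word [Vertex v])"
    have "b' = Poly_Mapping.single (Word [Vertex v]) c"
      using b'(1) by (intro poly_mapping_eqI) (auto simp: c_def lookup_single when_def in_keys_iff)
    then have eq: "b' = scalar c * p v"
      by (simp add: generator_def mult_single)
    have "b' \<in> B"
    proof (cases "c = 0")
      case True
      then show ?thesis using eq algebra_idealD(2)[OF B(1)] by simp
    next
      case False
      have "scalar (inverse c) * b' = p v"
        using False by (simp add: eq generator_def mult_single)
      then have "p v \<in> A" using algebra_idealD(4)[OF A(1) b'A, of "inverse c"] by simp
      then show ?thesis using verts[OF v] algebra_idealD(4)[OF B(1)] eq by simp
    qed
    then show "p v * b \<in> B" using cong_mem_iff_superset[OF B b'(2)] by simp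
  qed
next
  case (Suc m)
  obtain F where F: "finite F" "F \<subseteq> arcs E" "b * (\<Sum>f\<in>F. x f * y f) \<approx> b"
    using ghost_combination_expand[OF Suc.prems(1)] by blast
  have "b * (x f * y f) \<in> B" if "f \<in> F" for f
  proof -
    have f: "f \<in> arcs E" using that F by auto
    obtain b' where b': "Poly_Mapping.keys b' \<subseteq> normal_words (- int m) 0" "b * x f \<approx> b'"
      using cong_linear_cases[of 1 "x f" b "normal_words (- int m) 0"]
        ghost_words_mult_edge[OF f subsetD[OF Suc.prems(1)]] f
      by (auto simp: reduces_into_def)
    have "b * x f \<in> A" using algebra_idealD(6)[OF A(1)] f Suc.prems(2) by simp
    then have "b' \<in> A" using cong_mem_iff_superset[OF A b'(2)] by simp
    then have "b' \<in> B" using Suc.IH b'(1) by blast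
    then have "b * x f \<in> B" using cong_mem_iff_superset[OF B b'(2)] by simp
    then show ?thesis using algebra_idealD(6)[OF B(1), of "Ghost f"] f by (simp add: mult.assoc[symmetric])
  qed
  then have "b * (\<Sum>f\<in>F. x f * y f) \<in> B"
    by (simp add: sum_distrib_left algebra_ideal_sum[OF B(1)])
  then show ?case using cong_mem_iff_superset[OF B F(3)] by simp
qed

text \<open>If \<open>v\<close> emits edges, \<open>p\<^sub>v b = \<Sum> x\<^sub>e (y\<^sub>e b)\<close> and the bound drops in each \<open>y\<^sub>e b\<close>. If \<open>v\<close> is a sink, no word
that starts with an edge survives multiplication by \<open>p\<^sub>v\<close>, so the bound drops to \<open>0\<close>. The degree
changes from \<open>n\<close> to \<open>n - 1\<close> in the first case, which is why it is arbitrary in the induction.\<close>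

lemma normal_combination_mem:
  assumes A: "algebra_ideal L A" "I \<subseteq> A" and B: "algebra_ideal L B" "I \<subseteq> B"
    and verts: "\<And>v. v \<in> verts E \<Longrightarrow> p v \<in> A \<Longrightarrow> p v \<in> B"
    and "Poly_Mapping.keys b \<subseteq> normal_words n N" "b \<in> A"
  shows "b \<in> B"
  using assms(6,7)
proof (induction N arbitrary: n b)
  case 0
  show ?case
  proof (cases "n \<le> 0")
    case True
    then have "Poly_Mapping.keys b \<subseteq> normal_words (- int (nat (- n))) 0" using 0 by simp
    then show ?thesis using ghost_combination_mem[OF A B verts] 0(2) by blast
  next
    case False
    then have "normal_words n 0 = {}" by (auto elim!: normal_wordsE)
    then have "b = 0" using 0(1) by simp
    then show ?thesis using algebra_idealD(2)[OF B(1)] by simp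
  qed
next
  case (Suc N)
  show ?case
  proof (rule relator_ideal.mem_if_vertex_multiples_mem[OF relator_ideal_superset[OF B]])
    show "b \<in> free_carrier L" using Suc.prems(1) by (rule normal_words_carrier)
    fix v assume v: "v \<in> verts E"
    show "p v * b \<in> B"
    proof (cases "out_arcs E v = {}")
      case False
      have "x e * y e * b \<in> B" if e: "e \<in> out_arcs E v" for e
      proof -
        obtain b' where b': "Poly_Mapping.keys b' \<subseteq> normal_words (n - 1) N" "y e * b \<approx> b'"
          using cong_linear_cases[of "y e" 1 b "normal_words (n - 1) N"] e
            ghost_mult_normal[OF _ subsetD[OF Suc.prems(1)], of e]
          by (auto simp: reduces_into_def)
        have "y e * b \<in> A" using algebra_idealD(5)[OF A(1)] e Suc.prems(2) by simp
        then have "b' \<in> A" using cong_mem_iff_superset[OF A b'(2)] by simp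
        then have "b' \<in> B" using Suc.IH b'(1) by blast
        then have "y e * b \<in> B" using cong_mem_iff_superset[OF B b'(2)] by simp
        then show ?thesis using algebra_idealD(5)[OF B(1), of "Edge e"] e by (simp add: mult.assoc)
      qed
      then have "(\<Sum>e\<in>out_arcs E v. x e * y e) * b \<in> B"
        unfolding sum_distrib_right by (rule algebra_ideal_sum[OF B(1)])
      moreover have "p v * b \<approx> (\<Sum>e\<in>out_arcs E v. x e * y e) * b"
        using normal_words_carrier[OF Suc.prems(1)] free_carrier_span
        by (intro cong_mult_right p_eq_sum v False) blast
      ultimately show ?thesis using cong_mem_iff_superset[OF B] by blast
    next
      case True
      have "p v * Poly_Mapping.single w 1 * 1 \<in> I \<or>
          (\<exists>w'\<in>normal_words n 0. p v * Poly_Mapping.single w 1 * 1 \<approx> Poly_Mapping.single w' 1)"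
        if "w \<in> Poly_Mapping.keys b" for w
      proof (rule normal_wordsE[OF subsetD[OF Suc.prems(1) that]])
        fix \<alpha> u \<beta> assume w: "w = Word (normal_word \<alpha> u \<beta>)" "set \<alpha> \<subseteq> arcs E" "u \<in> verts E" "set \<beta> \<subseteq> arcs E"
          "length \<alpha> \<le> Suc N" "int (length \<alpha>) - int (length \<beta>) = n"
        show ?thesis
        proof (cases \<alpha>)
          case Nil
          then have "w \<in> normal_words n 0" using w by (auto intro!: normal_wordsI)
          then show ?thesis using vertex_mult_normal[OF v] by (simp add: reduces_into_def)
        next
          case (Cons e \<alpha>')
          have "p v * wm (normal_word \<alpha> u \<beta>) \<approx> (if v = tail E e then wm (normal_word \<alpha> u \<beta>) else 0)"
            using p_mult_word[OF v set_normal_word[OF w(2-4)]] by (simp add: Cons normal_word_def)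
          moreover have "v \<noteq> tail E e" using True w(2) Cons by auto
          ultimately show ?thesis by (simp add: w(1) cong_zero_iff)
        qed
      qed
      then obtain b' where b': "Poly_Mapping.keys b' \<subseteq> normal_words n 0" "p v * b \<approx> b'"
        using cong_linear_cases[of "p v" 1 b "normal_words n 0"] v by auto
      have "p v * b \<in> A" using algebra_idealD(5)[OF A(1)] v Suc.prems(2) by simp
      then have "b' \<in> A" using cong_mem_iff_superset[OF A b'(2)] by simp
      moreover have "Poly_Mapping.keys b' \<subseteq> normal_words n N"
        using b'(1) normal_words_mono[of 0 N] by blast
      ultimately have "b' \<in> B" using Suc.IH by blast
      then show ?thesis using cong_mem_iff_superset[OF B b'(2)] by simp
    qed
  qed
qed

lemma homogeneous_mem:
  assumes A: "algebra_ideal L A" "I \<subseteq> A" and B: "algebra_ideal L B" "I \<subseteq> B"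
    and verts: "\<And>v. v \<in> verts E \<Longrightarrow> p v \<in> A \<Longrightarrow> p v \<in> B"
    and a: "a \<in> A" "\<And>w. w \<in> Poly_Mapping.keys a \<Longrightarrow> word_degree w = n"
  shows "a \<in> B"
proof -
  have "1 * Poly_Mapping.single w 1 * 1 \<in> I \<or>
      (\<exists>w'\<in>\<Union>N. normal_words n N. 1 * Poly_Mapping.single w 1 * 1 \<approx> Poly_Mapping.single w' 1)"
    if w: "w \<in> Poly_Mapping.keys a" for w
  proof -
    have "a \<in> free_carrier L" using a(1) algebra_idealD(1)[OF A(1)] by blast
    then have "set (letters w) \<subseteq> L" "letters w \<noteq> []" using w unfolding free_carrier_eq by blast+
    from word_reduces_to_normal[OF this] show ?thesis
      using a(2)[OF w] by (simp add: reduces_into_def)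
  qed
  then obtain b where b: "Poly_Mapping.keys b \<subseteq> (\<Union>N. normal_words n N)" "a \<approx> b"
    using cong_linear_cases[of 1 1 a "\<Union>N. normal_words n N"] by auto
  have "\<exists>N. \<forall>w\<in>W. w \<in> normal_words n N" if "finite W" "W \<subseteq> (\<Union>N. normal_words n N)" for W
    using that
  proof (induction W rule: finite_induct)
    case (insert w W)
    then obtain N N' where "\<forall>w\<in>W. w \<in> normal_words n N" "w \<in> normal_words n N'" by auto
    then have "\<forall>w'\<in>insert w W. w' \<in> normal_words n (max N N')"
      using subsetD[OF normal_words_mono[of N "max N N'" n]] subsetD[OF normal_words_mono[of N' "max N N'" n]]
      by simp
    then show ?case by blast
  qed simp
  then obtain N where N: "Poly_Mapping.keys b \<subseteq> normal_words n N"
    using b(1) by (meson finite_keys subsetI)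
  have "b \<in> A" using a(1) cong_mem_iff_superset[OF A b(2)] by simp
  then have "b \<in> B" using normal_combination_mem[OF A B verts N] by blast
  then show ?thesis using cong_mem_iff_superset[OF B b(2)] by simp
qed

end

section \<open>Graded ideals of the free algebra\<close>

definition homogeneous_part ::
  "int \<Rightarrow> (('v, 'e) letter free_word \<Rightarrow>\<^sub>0 'k::field) \<Rightarrow> (('v, 'e) letter free_word \<Rightarrow>\<^sub>0 'k)" where
  "homogeneous_part n a =
     (\<Sum>w\<in>{w \<in> Poly_Mapping.keys a. word_degree w = n}. Poly_Mapping.single w (Poly_Mapping.lookup a w))"

definition homogeneous :: "int \<Rightarrow> (('v, 'e) letter free_word \<Rightarrow>\<^sub>0 'k::field) \<Rightarrow> bool" where
  "homogeneous n a \<longleftrightarrow> (\<forall>w\<in>Poly_Mapping.keys a. word_degree w = n)"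

definition graded_set :: "(('v, 'e) letter free_word \<Rightarrow>\<^sub>0 'k::field) set \<Rightarrow> bool" where
  "graded_set I \<longleftrightarrow> (\<forall>a\<in>I. \<forall>n. homogeneous_part n a \<in> I)"

lemma lookup_homogeneous_part [simp]:
  "Poly_Mapping.lookup (homogeneous_part n a) w = (if word_degree w = n then Poly_Mapping.lookup a w else 0)"
  by (auto simp: homogeneous_part_def lookup_sum lookup_single when_def in_keys_iff)

lemma homogeneous_part_add: "homogeneous_part n (a + b) = homogeneous_part n a + homogeneous_part n b"
  by (rule poly_mapping_eqI) (simp add: lookup_add)

lemma homogeneous_part_diff: "homogeneous_part n (a - b) = homogeneous_part n a - homogeneous_part n b"
  by (rule poly_mapping_eqI) (simp add: lookup_minus)

lemma homogeneous_part_zero [simp]: "homogeneous_part n 0 = 0"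
  by (rule poly_mapping_eqI) simp

lemma homogeneous_part_sum: "homogeneous_part n (sum a F) = (\<Sum>i\<in>F. homogeneous_part n (a i))"
  by (rule poly_mapping_eqI) (simp add: lookup_sum)

lemma homogeneous_part_single:
  "homogeneous_part n (Poly_Mapping.single w c) = (if word_degree w = n then Poly_Mapping.single w c else 0)"
  by (rule poly_mapping_eqI) (auto simp: lookup_single when_def)

lemma homogeneous_part_homogeneous: "homogeneous m a \<Longrightarrow> homogeneous_part n a = (if m = n then a else 0)"
  by (rule poly_mapping_eqI) (auto simp: homogeneous_def in_keys_iff)

lemma homogeneous_homogeneous_part: "homogeneous n (homogeneous_part n a)"
  by (auto simp: homogeneous_def in_keys_iff split: if_splits)

lemma sum_homogeneous_parts:
  assumes "finite N" "\<And>n. n \<notin> N \<Longrightarrow> homogeneous_part n a = 0"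
  shows "(\<Sum>n\<in>N. homogeneous_part n a) = a"
proof (rule poly_mapping_eqI)
  fix w
  have "Poly_Mapping.lookup a w = 0" if "word_degree w \<notin> N"
    using lookup_homogeneous_part[of "word_degree w" a w] assms(2)[OF that] by simp
  then show "Poly_Mapping.lookup (\<Sum>n\<in>N. homogeneous_part n a) w = Poly_Mapping.lookup a w"
    using assms(1) by (auto simp: lookup_sum)
qed

lemma finite_homogeneous_parts: "finite {n. homogeneous_part n a \<noteq> 0}"
proof (rule finite_subset)
  show "{n. homogeneous_part n a \<noteq> 0} \<subseteq> word_degree ` Poly_Mapping.keys a"
  proof
    fix n assume "n \<in> {n. homogeneous_part n a \<noteq> 0}"
    then obtain w where "Poly_Mapping.lookup (homogeneous_part n a) w \<noteq> 0"
      by (auto simp: poly_mapping_eq_iff fun_eq_iff)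
    then show "n \<in> word_degree ` Poly_Mapping.keys a"
      by (auto simp: in_keys_iff split: if_splits)
  qed
qed simp

lemma word_degree_plus: "word_degree (u + w) = word_degree u + word_degree w"
  by (simp add: word_degree_def)

lemma homogeneous_part_generator_mult:
  "homogeneous_part n (generator l * a) = generator l * homogeneous_part (n - letter_degree l) a"
  "homogeneous_part n (a * generator l) = homogeneous_part (n - letter_degree l) a * generator l"
proof -
  have "homogeneous_part n (generator l * a) = generator l * homogeneous_part (n - letter_degree l) a \<and>
      homogeneous_part n (a * generator l) = homogeneous_part (n - letter_degree l) a * generator l"
    using subset_UNIV[of "Poly_Mapping.keys a"]
    by (induction rule: poly_mapping_span_induct)
       (auto simp: homogeneous_part_add algebra_simps generator_def mult_single homogeneous_part_single
         word_degree_def plus_free_word_def)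
  then show
    "homogeneous_part n (generator l * a) = generator l * homogeneous_part (n - letter_degree l) a"
    "homogeneous_part n (a * generator l) = homogeneous_part (n - letter_degree l) a * generator l"
    by auto
qed

lemma homogeneous_part_scalar_mult: "homogeneous_part n (scalar c * a) = scalar c * homogeneous_part n a"
  using subset_UNIV[of "Poly_Mapping.keys a"]
  by (induction rule: poly_mapping_span_induct)
     (auto simp: homogeneous_part_add algebra_simps mult_single homogeneous_part_single)

lemma homogeneous_zero: "homogeneous n 0"
  by (simp add: homogeneous_def)

lemma homogeneous_generator: "letter_degree l = n \<Longrightarrow> homogeneous n (generator l)"
  by (auto simp: homogeneous_def generator_def word_degree_def)

lemma homogeneous_diff: "homogeneous n a \<Longrightarrow> homogeneous n b \<Longrightarrow> homogeneous n (a - b)"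
  using keys_of_Diff[of a b] by (auto simp: homogeneous_def)

lemma homogeneous_mult: "homogeneous m a \<Longrightarrow> homogeneous n b \<Longrightarrow> m + n = k \<Longrightarrow> homogeneous k (a * b)"
  using keys_mult[of a b] by (fastforce simp: homogeneous_def word_degree_plus)

lemma homogeneous_sum: "(\<And>i. i \<in> F \<Longrightarrow> homogeneous n (a i)) \<Longrightarrow> homogeneous n (sum a F)"
  using keys_sum[of a F] by (auto simp: homogeneous_def)

text \<open>The elements whose homogeneous components all lie in the ideal form an ideal that contains the
generators.\<close>

lemma graded_set_generated_ideal:
  assumes "R \<subseteq> free_carrier S" and "\<And>r. r \<in> R \<Longrightarrow> \<exists>n. homogeneous n r"
  shows "graded_set (generated_ideal S R)"
proof -
  let ?I = "generated_ideal S R"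
  note I = algebra_ideal_generated[OF assms(1)]
  have "algebra_ideal S {a \<in> ?I. \<forall>n. homogeneous_part n a \<in> ?I}"
    using I unfolding algebra_ideal_def
    by (auto simp: homogeneous_part_add homogeneous_part_generator_mult homogeneous_part_scalar_mult)
  moreover have "R \<subseteq> {a \<in> ?I. \<forall>n. homogeneous_part n a \<in> ?I}"
  proof
    fix r assume r: "r \<in> R"
    then obtain m where "homogeneous m r" using assms(2) by blast
    then show "r \<in> {a \<in> ?I. \<forall>n. homogeneous_part n a \<in> ?I}"
      using r generated_ideal_superset[of R S] algebra_idealD(2)[OF I]
      by (auto simp: homogeneous_part_homogeneous)
  qed
  ultimately have "?I \<subseteq> {a \<in> ?I. \<forall>n. homogeneous_part n a \<in> ?I}"
    by (rule generated_ideal_least)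
  then show ?thesis by (auto simp: graded_set_def)
qed

section \<open>The ideal generated by a set of vertices\<close>

definition vertex_ideal ::
  "('v, 'e) pre_digraph \<Rightarrow> 'v set \<Rightarrow> (('v, 'e) letter free_word \<Rightarrow>\<^sub>0 'k::field) set" where
  "vertex_ideal E H = generated_ideal (graph_letters E) (graph_relators E \<union> gen_p ` H)"

lemma graph_ideal_eq_vertex_ideal: "graph_ideal E = vertex_ideal E {}"
  by (simp add: graph_ideal_def vertex_ideal_def)

lemma relators_in_vertex_ideal: "graph_relators E \<subseteq> vertex_ideal E H"
  and vertices_in_vertex_ideal: "v \<in> H \<Longrightarrow> gen_p v \<in> vertex_ideal E H"
  unfolding vertex_ideal_def by (auto intro: generated_ideal_superset[THEN subsetD])

lemma vertex_ideal_least: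
  "algebra_ideal (graph_letters E) I \<Longrightarrow> graph_relators E \<subseteq> I \<Longrightarrow> gen_p ` H \<subseteq> I \<Longrightarrow> vertex_ideal E H \<subseteq> I"
  unfolding vertex_ideal_def by (rule generated_ideal_least) auto

context row_finite_graph
begin

lemma graph_relators_carrier: "graph_relators E \<subseteq> free_carrier (graph_letters E)"
  unfolding graph_relators_def
  by (auto intro!: free_carrier_diff free_carrier_sum free_carrier_mult_left span_words_generator
      free_carrier_generator)

lemma graph_relators_homogeneous: "r \<in> graph_relators E \<Longrightarrow> \<exists>n. homogeneous n r"
proof -
  have p: "homogeneous 0 (gen_p v)" for v
    by (simp add: homogeneous_generator)
  have x: "homogeneous 1 (gen_x e)" for e
    by (simp add: homogeneous_generator)
  have y: "homogeneous (- 1) (gen_y e)" for e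
    by (simp add: homogeneous_generator)
  have p': "homogeneous 0 (if c then gen_p v else 0)" for c v
    by (simp add: p homogeneous_zero)
  assume "r \<in> graph_relators E"
  then have "homogeneous 0 r \<or> homogeneous 1 r \<or> homogeneous (- 1) r"
    unfolding graph_relators_def
    by (auto intro!: homogeneous_diff homogeneous_mult[OF p p] homogeneous_mult[OF p x] homogeneous_mult[OF x p]
        homogeneous_mult[OF p y] homogeneous_mult[OF y p] homogeneous_mult[OF x y] homogeneous_mult[OF y x]
        homogeneous_sum p p' x y)
  then show ?thesis by blast
qed

lemma algebra_ideal_vertex_ideal: "H \<subseteq> verts E \<Longrightarrow> algebra_ideal (graph_letters E) (vertex_ideal E H)"
  unfolding vertex_ideal_def using graph_relators_carrier by (intro algebra_ideal_generated) auto

lemma relator_ideal_vertex_ideal: "H \<subseteq> verts E \<Longrightarrow> relator_ideal E (vertex_ideal E H)"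
  by unfold_locales (simp_all add: algebra_ideal_vertex_ideal relators_in_vertex_ideal)

lemma graded_vertex_ideal: "H \<subseteq> verts E \<Longrightarrow> graded_set (vertex_ideal E H)"
  unfolding vertex_ideal_def
proof (rule graded_set_generated_ideal)
  assume "H \<subseteq> verts E"
  then show "graph_relators E \<union> gen_p ` H \<subseteq> free_carrier (graph_letters E)"
    using graph_relators_carrier by auto
  fix r assume "r \<in> graph_relators E \<union> gen_p ` H"
  then show "\<exists>n. homogeneous n r"
    by (auto intro: graph_relators_homogeneous exI[of _ 0] homogeneous_generator)
qed

section \<open>Graded ideals are determined by their vertices\<close>

text \<open>The reduction to normal words takes place modulo \<open>A \<inter> B\<close>, which contains the relators, so
that membership in \<open>A\<close> and membership in \<open>B\<close> are both unaffected by it.\<close>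

lemma graded_ideal_subset:
  assumes A: "relator_ideal E A" "graded_set A" and B: "relator_ideal E B"
    and verts: "\<And>v. v \<in> verts E \<Longrightarrow> gen_p v \<in> A \<Longrightarrow> gen_p v \<in> B"
  shows "A \<subseteq> B"
proof
  interpret A: relator_ideal E A by fact
  interpret B: relator_ideal E B by fact
  interpret AB: relator_ideal E "A \<inter> B"
    using A.ideal B.ideal A.relators B.relators by unfold_locales (auto simp: algebra_ideal_def)
  fix a assume a: "a \<in> A"
  have "homogeneous_part n a \<in> B" for n
    using A(2) a homogeneous_homogeneous_part[of n a] verts
    by (intro AB.homogeneous_mem[OF A.ideal _ B.ideal, of "homogeneous_part n a" n])
       (auto simp: graded_set_def homogeneous_def)
  then have "(\<Sum>n\<in>{n. homogeneous_part n a \<noteq> 0}. homogeneous_part n a) \<in> B"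
    by (intro algebra_ideal_sum[OF B.ideal])
  then show "a \<in> B"
    using sum_homogeneous_parts[OF finite_homogeneous_parts[of a], of a] by simp
qed

end

section \<open>A representation that separates the vertices outside a hereditary saturated set\<close>

definition linear_extension :: "('x \<Rightarrow> 'k) \<Rightarrow> ('x \<Rightarrow>\<^sub>0 'k::field) \<Rightarrow> 'k" where
  "linear_extension \<phi> a = (\<Sum>w\<in>Poly_Mapping.keys a. Poly_Mapping.lookup a w * \<phi> w)"

lemma linear_extension_superset:
  "finite W \<Longrightarrow> Poly_Mapping.keys a \<subseteq> W \<Longrightarrow> linear_extension \<phi> a = (\<Sum>w\<in>W. Poly_Mapping.lookup a w * \<phi> w)"
  unfolding linear_extension_def by (rule sum.mono_neutral_left) (auto simp: in_keys_iff)

lemma linear_extension_add: "linear_extension \<phi> (a + b) = linear_extension \<phi> a + linear_extension \<phi> b"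
  using linear_extension_superset[of "Poly_Mapping.keys a \<union> Poly_Mapping.keys b" _ \<phi>] keys_add[of a b]
  by (simp add: lookup_add distrib_right sum.distrib)

lemma linear_extension_diff: "linear_extension \<phi> (a - b) = linear_extension \<phi> a - linear_extension \<phi> b"
  using linear_extension_add[of \<phi> "a - b" b] by simp

lemma linear_extension_zero [simp]: "linear_extension \<phi> 0 = 0"
  by (simp add: linear_extension_def)

lemma linear_extension_sum: "linear_extension \<phi> (sum a F) = (\<Sum>i\<in>F. linear_extension \<phi> (a i))"
  by (induction F rule: infinite_finite_induct) (auto simp: linear_extension_add)

lemma linear_extension_single [simp]: "linear_extension \<phi> (Poly_Mapping.single w c) = c * \<phi> w"
  by (simp add: linear_extension_def)

locale hereditary_saturated = row_finite_graph E for E :: "('v, 'e) pre_digraph" +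
  fixes H :: "'v set"
  assumes hereditary: "hereditary E H" and saturated: "saturated E H"
begin

text \<open>The representation lives on functions on the set of pairs \<open>(v, m)\<close>, with \<open>m\<close> a natural number.
If \<open>v \<notin> H\<close> emits edges, the pairs at \<open>v\<close> are identified with the pairs of a surviving edge
and a natural number; this is possible because there is at least one and at most countably many such edges.\<close>

definition surviving_arcs :: "'v \<Rightarrow> 'e set" where
  "surviving_arcs v = {e \<in> out_arcs E v. head E e \<notin> H}"

definition encode :: "'v \<Rightarrow> 'e \<times> nat \<Rightarrow> nat" where
  "encode v = to_nat_on (surviving_arcs v \<times> UNIV)"

definition decode :: "'v \<Rightarrow> nat \<Rightarrow> 'e \<times> nat" where
  "decode v = from_nat_into (surviving_arcs v \<times> UNIV)"

lemma countable_surviving: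
  assumes "v \<in> verts E" shows "countable (surviving_arcs v \<times> (UNIV :: nat set))"
proof -
  have "finite (surviving_arcs v)"
    by (rule finite_subset[OF _ finite_out_arcs[OF assms]]) (auto simp: surviving_arcs_def)
  then show ?thesis by (intro countable_SIGMA) (auto intro: countable_finite)
qed

lemma tail_notin: "e \<in> arcs E \<Longrightarrow> head E e \<notin> H \<Longrightarrow> tail E e \<notin> H"
  using hereditary_head[OF wf_digraph_axioms hereditary] by blast

lemma decode_encode: "e \<in> arcs E \<Longrightarrow> head E e \<notin> H \<Longrightarrow> decode (tail E e) (encode (tail E e) (e, m)) = (e, m)"
  unfolding decode_def encode_def
  by (intro from_nat_into_to_nat_on countable_surviving) (auto simp: surviving_arcs_def)

lemma
  assumes "v \<in> verts E" "out_arcs E v \<noteq> {}" "v \<notin> H"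
  shows decode_surviving: "fst (decode v m) \<in> surviving_arcs v"
    and encode_decode: "encode v (decode v m) = m"
proof -
  have ne: "surviving_arcs v \<noteq> {}"
    using saturated assms unfolding saturated_def surviving_arcs_def by blast
  have "decode v m \<in> surviving_arcs v \<times> UNIV"
    unfolding decode_def by (rule from_nat_into) (use ne in auto)
  then show "fst (decode v m) \<in> surviving_arcs v" by auto
  have "infinite (surviving_arcs v \<times> (UNIV :: nat set))"
    using ne by (auto simp: finite_cartesian_product_iff)
  then show "encode v (decode v m) = m"
    unfolding encode_def decode_def
    by (intro to_nat_on_from_nat_into_infinite countable_surviving assms)
qed

text \<open>An edge \<open>e\<close> embeds the pairs at its head into the pairs at its tail. Functions are pulled back along
the inverse of this embedding for \<open>x\<^sub>e\<close> and along the embedding for \<open>y\<^sub>e\<close>, with value zero where the map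
is undefined; \<open>p\<^sub>v\<close> restricts functions to the pairs at \<open>v\<close>.\<close>

fun act :: "('v, 'e) letter \<Rightarrow> ('v \<times> nat \<Rightarrow> 'k::field) \<Rightarrow> 'v \<times> nat \<Rightarrow> 'k" where
  "act (Vertex v) g (u, m) = (if u = v \<and> v \<notin> H then g (u, m) else 0)"
| "act (Edge e) g (u, m) = (if u = tail E e \<and> head E e \<notin> H \<and> fst (decode u m) = e
      then g (head E e, snd (decode u m)) else 0)"
| "act (Ghost e) g (u, m) = (if u = head E e \<and> head E e \<notin> H then g (tail E e, encode (tail E e) (e, m)) else 0)"

lemma act_zero: "act l (\<lambda>z. 0) z = 0"
  by (cases l; cases z) auto

lemma act_add: "act l (\<lambda>z. f z + g z) z = act l f z + act l g z"
  by (cases l; cases z) auto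

lemma act_mult: "act l (\<lambda>z. c * f z) z = c * act l f z"
  by (cases l; cases z) auto

definition rep :: "(('v, 'e) letter free_word \<Rightarrow>\<^sub>0 'k::field) \<Rightarrow> ('v \<times> nat \<Rightarrow> 'k) \<Rightarrow> 'v \<times> nat \<Rightarrow> 'k" where
  "rep a g z = linear_extension (\<lambda>w. foldr act (letters w) g z) a"

lemma rep_simps:
  "rep 0 g z = 0" "rep (a + b) g z = rep a g z + rep b g z" "rep (a - b) g z = rep a g z - rep b g z"
  "rep (sum c F) g z = (\<Sum>i\<in>F. rep (c i) g z)" "rep (generator l) g z = act l g z"
  by (simp_all add: rep_def linear_extension_add linear_extension_diff linear_extension_sum generator_def)

lemma rep_scalar: "rep (scalar c * a) g z = c * rep a g z"
  using subset_UNIV[of "Poly_Mapping.keys a"]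
  by (induction rule: poly_mapping_span_induct) (auto simp: rep_simps algebra_simps, simp add: rep_def mult_single)

lemma rep_generator_mult: "rep (generator l * a) g z = act l (rep a g) z"
  using subset_UNIV[of "Poly_Mapping.keys a"]
proof (induction rule: poly_mapping_span_induct)
  case zero
  then show ?case using act_zero by (simp add: rep_simps(1)[abs_def] rep_simps(1))
next
  case (single w c)
  have "rep (Poly_Mapping.single w c) g = (\<lambda>z. c * foldr act (letters w) g z)"
    by (rule ext) (simp add: rep_def)
  then show ?case by (simp add: act_mult) (simp add: rep_def generator_def mult_single)
next
  case (add a b)
  have "rep (a + b) g = (\<lambda>z. rep a g z + rep b g z)"
    by (rule ext) (simp add: rep_simps)
  then show ?case using add by (simp add: act_add rep_simps algebra_simps)
qed

lemma rep_mult_generator: "rep (a * generator l) g z = rep a (act l g) z"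
  using subset_UNIV[of "Poly_Mapping.keys a"]
  by (induction rule: poly_mapping_span_induct)
     (auto simp: rep_simps algebra_simps, simp add: rep_def generator_def mult_single)

lemma algebra_ideal_rep_kernel:
  "algebra_ideal (graph_letters E) {a \<in> free_carrier (graph_letters E). \<forall>g z. rep a g z = (0::'k::field)}"
proof -
  have "act l (rep a g) z = 0" if "\<forall>g z. rep a g z = (0::'k)" for l a g z
  proof -
    have "rep a g = (\<lambda>z. 0)" using that by auto
    then show ?thesis by (simp add: act_zero)
  qed
  then show ?thesis
    unfolding algebra_ideal_def by (auto simp: rep_simps rep_scalar rep_generator_mult rep_mult_generator)
qed

text \<open>The images of the surviving edges partition the pairs at \<open>v\<close>, so \<open>x\<^sub>e y\<^sub>e\<close>, summed over the edges, is
the restriction to these pairs. Saturation is needed for surjectivity: without a surviving edge nothing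
would be covered.\<close>

lemma rep_out_arcs_sum:
  assumes v: "v \<in> verts E" "out_arcs E v \<noteq> {}"
  shows "(\<Sum>e\<in>out_arcs E v. act (Edge e) (act (Ghost e) g) z) = act (Vertex v) g z"
proof (cases z)
  case (Pair u m)
  show ?thesis
  proof (cases "u = v \<and> v \<notin> H")
    case True
    define e where "e = fst (decode v m)"
    have e: "e \<in> out_arcs E v" "head E e \<notin> H"
      using decode_surviving[OF v, of m] True by (auto simp: e_def surviving_arcs_def)
    have "act (Edge f) (act (Ghost f) g) z = (if f = e then g z else 0)" if "f \<in> out_arcs E v" for f
      using that True e encode_decode[OF v, of m] by (auto simp: Pair e_def)
    then have "(\<Sum>f\<in>out_arcs E v. act (Edge f) (act (Ghost f) g) z) = (\<Sum>f\<in>out_arcs E v. if f = e then g z else 0)"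
      by (rule sum.cong[OF HOL.refl])
    then show ?thesis using e v True by (simp add: Pair)
  next
    case False
    then have "act (Edge e) (act (Ghost e) g) z = 0" if "e \<in> out_arcs E v" for e
      using that tail_notin[of e] by (auto simp: Pair)
    then have "(\<Sum>e\<in>out_arcs E v. act (Edge e) (act (Ghost e) g) z) = 0"
      by (rule sum.neutral[OF ballI])
    moreover have "act (Vertex v) g z = 0"
      using False by (auto simp: Pair)
    ultimately show ?thesis by simp
  qed
qed

lemma rep_relator:
  assumes "r \<in> graph_relators E"
  shows "rep r g z = 0"
proof -
  have gen: "rep (generator l) g = act l g" for l and g :: "'v \<times> nat \<Rightarrow> 'b::field"
    by (rule ext) (simp add: rep_simps)
  show ?thesis
  proof (cases "\<exists>v\<in>verts E. out_arcs E v \<noteq> {} \<and> r = gen_p v - (\<Sum>e\<in>out_arcs E v. gen_x e * gen_y e)")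
    case True
    then obtain v where "v \<in> verts E" "out_arcs E v \<noteq> {}"
      and r: "r = gen_p v - (\<Sum>e\<in>out_arcs E v. gen_x e * gen_y e)" by blast
    then show ?thesis
      using rep_out_arcs_sum[of v g z] by (simp add: r rep_simps rep_generator_mult gen)
  next
    case False
    then show ?thesis
      using assms unfolding graph_relators_def
      by (cases z) (auto simp: rep_simps rep_generator_mult gen tail_notin decode_encode)
  qed
qed

text \<open>The kernel of the representation contains the relators and \<open>H\<close>, but no vertex outside \<open>H\<close>, since
such a vertex fixes the constant function \<open>1\<close> at its own pairs.\<close>

lemma vertex_in_vertex_ideal_iff:
  assumes "v \<in> verts E"
  shows "(gen_p v :: ('v, 'e) letter free_word \<Rightarrow>\<^sub>0 'k::field) \<in> vertex_ideal E H \<longleftrightarrow> v \<in> H"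
proof
  let ?Z = "{a \<in> free_carrier (graph_letters E). \<forall>g z. rep a g z = (0::'k)}"
  have "gen_p ` H \<subseteq> ?Z"
    using hereditary by (auto simp: rep_simps hereditary_def)
  then have "vertex_ideal E H \<subseteq> ?Z"
    using graph_relators_carrier rep_relator by (intro vertex_ideal_least algebra_ideal_rep_kernel) auto
  moreover assume "(gen_p v :: ('v, 'e) letter free_word \<Rightarrow>\<^sub>0 'k) \<in> vertex_ideal E H"
  ultimately have "rep (gen_p v) (\<lambda>_. 1) (v, 0) = (0 :: 'k)" by blast
  then show "v \<in> H" by (auto simp: rep_simps split: if_splits)
qed (rule vertices_in_vertex_ideal)

end

section \<open>The vertices in an ideal\<close>

text \<open>Heredity comes from \<open>p\<^bsub>r(e)\<^esub> = y\<^sub>e p\<^bsub>s(e)\<^esub> x\<^sub>e\<close> and saturation from \<open>p\<^sub>v = \<Sum> x\<^sub>e p\<^bsub>r(e)\<^esub> y\<^sub>e\<close>.\<close>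

lemma (in relator_ideal) hereditary_saturated_vertices:
  "{v \<in> verts E. p v \<in> I} \<in> hereditary_saturated_sets E"
proof -
  let ?H = "{v \<in> verts E. p v \<in> I}"
  have "hereditary E ?H"
  proof (rule hereditaryI[OF wf_digraph_axioms])
    fix e assume e: "e \<in> arcs E" "tail E e \<in> ?H"
    have "y e * p (tail E e) * x e \<in> I"
      using e algebra_idealD(5,6)[OF ideal] by simp
    moreover have "y e * p (tail E e) * x e \<approx> y e * x e"
      using e by (intro cong_mult_right y_mult_p) auto
    moreover have "y e * x e \<approx> p (head E e)"
      using y_mult_x[OF e(1) e(1)] by simp
    ultimately show "head E e \<in> ?H" using e cong_mem_iff by auto
  qed auto
  moreover have "saturated E ?H"
    unfolding saturated_def
  proof (intro ballI impI)
    fix v assume v: "v \<in> verts E" "out_arcs E v \<noteq> {} \<and> head E ` out_arcs E v \<subseteq> ?H"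
    have "x e * y e \<in> I" if "e \<in> out_arcs E v" for e
    proof -
      have "p (head E e) \<in> I" using v that by blast
      then have "x e * (p (head E e) * y e) \<in> I"
        using that algebra_idealD(5,6)[OF ideal] by simp
      moreover have "x e * (p (head E e) * y e) \<approx> x e * y e"
        using that by (intro cong_mult_left p_mult_y) auto
      ultimately show ?thesis using cong_mem_iff by blast
    qed
    then have "(\<Sum>e\<in>out_arcs E v. x e * y e) \<in> I" by (rule algebra_ideal_sum[OF ideal])
    then show "v \<in> ?H" using v p_eq_sum[of v] cong_mem_iff by auto
  qed
  ultimately show ?thesis by (simp add: hereditary_saturated_sets_def)
qed

section \<open>Ideals of a quotient of the free algebra\<close>

text \<open>The usual correspondence between ideals of a quotient and ideals above the kernel, for the
quotient of the free algebra as a ring without unit.\<close>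

locale free_quotient =
  fixes S :: "'x set" and J :: "('x free_word \<Rightarrow>\<^sub>0 'k::field) set"
  assumes ideal: "algebra_ideal S J"
begin

abbreviation Q :: "('k, ('x free_word \<Rightarrow>\<^sub>0 'k) set) module" where
  "Q \<equiv> quotient_algebra (free_algebra S) J"

abbreviation coset :: "('x free_word \<Rightarrow>\<^sub>0 'k) \<Rightarrow> ('x free_word \<Rightarrow>\<^sub>0 'k) set" where
  "coset a \<equiv> J +>\<^bsub>free_algebra S\<^esub> a"

lemma mem_coset_iff: "b \<in> coset a \<longleftrightarrow> b - a \<in> J"
  unfolding a_r_coset_def' by (auto intro: bexI[of _ "b - a"])

lemma coset_eq_iff: "coset a = coset b \<longleftrightarrow> a - b \<in> J"
proof
  assume "coset a = coset b"
  then show "a - b \<in> J"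
    using mem_coset_iff[of a a] mem_coset_iff[of a b] algebra_idealD(2)[OF ideal] by simp
next
  assume "a - b \<in> J"
  then have "c - a \<in> J \<longleftrightarrow> c - b \<in> J" for c
    using algebra_idealD(3)[OF ideal, of "c - a" "a - b"] algebra_ideal_diff[OF ideal, of "c - b" "a - b"]
    by auto
  then show "coset a = coset b" by (auto simp: mem_coset_iff)
qed

lemma coset_zero: "coset 0 = J"
  by (auto simp: mem_coset_iff)

lemma carrier_quotient: "carrier Q = coset ` free_carrier S"
  by (auto simp: quotient_algebra_def ring.defs module.defs FactRing_def A_RCOSETS_def')

lemma zero_quotient: "\<zero>\<^bsub>Q\<^esub> = coset 0"
  by (simp add: quotient_algebra_def ring.defs module.defs FactRing_def coset_zero)

lemma add_quotient: "coset a \<oplus>\<^bsub>Q\<^esub> coset b = coset (a + b)"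
proof -
  have "c \<in> coset a \<oplus>\<^bsub>Q\<^esub> coset b \<longleftrightarrow> c \<in> coset (a + b)" for c
  proof -
    have "c \<in> coset a \<oplus>\<^bsub>Q\<^esub> coset b \<longleftrightarrow> (\<exists>a'\<in>coset a. \<exists>b'\<in>coset b. c = a' + b')"
      by (auto simp: quotient_algebra_def ring.defs module.defs FactRing_def set_add_def set_mult_def)
    also have "\<dots> \<longleftrightarrow> c - (a + b) \<in> J"
    proof
      assume "\<exists>a'\<in>coset a. \<exists>b'\<in>coset b. c = a' + b'"
      then obtain a' b' where "a' - a \<in> J" "b' - b \<in> J" "c = a' + b'" by (auto simp: mem_coset_iff)
      then show "c - (a + b) \<in> J"
        using algebra_idealD(3)[OF ideal, of "a' - a" "b' - b"] by (simp add: algebra_simps)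
    next
      assume c: "c - (a + b) \<in> J"
      show "\<exists>a'\<in>coset a. \<exists>b'\<in>coset b. c = a' + b'"
        by (rule bexI[of _ "c - b"], rule bexI[of _ b])
           (use c algebra_idealD(2)[OF ideal] in \<open>auto simp: mem_coset_iff algebra_simps\<close>)
    qed
    finally show ?thesis by (simp add: mem_coset_iff)
  qed
  then show ?thesis by blast
qed

lemma mult_quotient:
  assumes "a \<in> free_carrier S" "b \<in> free_carrier S"
  shows "coset a \<otimes>\<^bsub>Q\<^esub> coset b = coset (a * b)"
proof -
  have *: "coset (a' * b') = coset (a * b)" if "a' \<in> coset a" "b' \<in> coset b" for a' b'
  proof -
    have J: "a' - a \<in> J" "b' - b \<in> J" using that by (auto simp: mem_coset_iff)
    have "b' - b \<in> free_carrier S" using J(2) algebra_idealD(1)[OF ideal] by blast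
    then have "b + (b' - b) \<in> free_carrier S" using assms(2) by (rule free_carrier_add[rotated])
    then have "b' \<in> span_words S" "a \<in> span_words S"
      using assms(1) subsetD[OF free_carrier_span] by auto
    then have "(a' - a) * b' + a * (b' - b) \<in> J"
      using algebra_ideal_mult[OF ideal] J algebra_idealD(3)[OF ideal] by blast
    then show ?thesis by (simp add: coset_eq_iff algebra_simps)
  qed
  have "coset a \<otimes>\<^bsub>Q\<^esub> coset b = (\<Union>a'\<in>coset a. \<Union>b'\<in>coset b. coset (a' * b'))"
    by (simp add: quotient_algebra_def ring.defs module.defs FactRing_def rcoset_mult_def)
  also have "\<dots> = (\<Union>a'\<in>coset a. \<Union>b'\<in>coset b. coset (a * b))"
    by (intro SUP_cong HOL.refl *)
  also have "\<dots> = coset (a * b)"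
  proof -
    have "a \<in> coset a" "b \<in> coset b" using algebra_idealD(2)[OF ideal] by (auto simp: mem_coset_iff)
    then show ?thesis by blast
  qed
  finally show ?thesis .
qed

lemma abelian_group_quotient: "abelian_group Q"
proof (rule abelian_groupI)
  fix X assume "X \<in> carrier Q"
  then obtain a where "a \<in> free_carrier S" "X = coset a" by (auto simp: carrier_quotient)
  then show "\<exists>Y\<in>carrier Q. Y \<oplus>\<^bsub>Q\<^esub> X = \<zero>\<^bsub>Q\<^esub>"
    by (intro bexI[of _ "coset (- a)"]) (auto simp: carrier_quotient add_quotient zero_quotient)
qed (auto simp: carrier_quotient add_quotient zero_quotient add_ac)

sublocale quotient: abelian_group Q
  by (rule abelian_group_quotient)

lemma uminus_quotient: "a \<in> free_carrier S \<Longrightarrow> \<ominus>\<^bsub>Q\<^esub> coset a = coset (- a)"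
  by (rule quotient.minus_equality) (auto simp: carrier_quotient add_quotient zero_quotient)

lemma finsum_quotient:
  assumes "finite F" "\<And>i. i \<in> F \<Longrightarrow> b i \<in> free_carrier S"
  shows "finsum Q (\<lambda>i. coset (b i)) F = coset (\<Sum>i\<in>F. b i)"
  using assms
proof (induction F rule: finite_induct)
  case empty
  then show ?case by (simp add: zero_quotient)
next
  case (insert i F)
  then show ?case
    by (subst quotient.finsum_insert) (auto simp: carrier_quotient add_quotient)
qed

definition preimage :: "('x free_word \<Rightarrow>\<^sub>0 'k) set set \<Rightarrow> ('x free_word \<Rightarrow>\<^sub>0 'k) set" where
  "preimage I = {a \<in> free_carrier S. coset a \<in> I}"

lemma coset_image_iff:
  assumes "algebra_ideal S K" "J \<subseteq> K"
  shows "coset a \<in> coset ` K \<longleftrightarrow> a \<in> K"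
proof
  assume "coset a \<in> coset ` K"
  then obtain b where "b \<in> K" "a - b \<in> J" by (auto simp: coset_eq_iff)
  then show "a \<in> K" using algebra_idealD(3)[OF assms(1), of "a - b" b] assms(2) by auto
qed auto

lemma preimage_image: "algebra_ideal S K \<Longrightarrow> J \<subseteq> K \<Longrightarrow> preimage (coset ` K) = K"
  using coset_image_iff[of K] algebra_idealD(1)[of S K] by (auto simp: preimage_def)

lemma image_preimage: "I \<subseteq> carrier Q \<Longrightarrow> coset ` preimage I = I"
  by (auto simp: preimage_def carrier_quotient)

lemma two_sided_ideal_image:
  assumes K: "algebra_ideal S K" and "J \<subseteq> K"
  shows "two_sided_ideal (coset ` K) Q"
proof -
  have sub: "K \<subseteq> free_carrier S" using algebra_idealD(1)[OF K] .
  have "subgroup (coset ` K) (add_monoid Q)"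
  proof (rule group.subgroupI[OF quotient.a_group])
    show "coset ` K \<subseteq> carrier (add_monoid Q)" using sub by (auto simp: carrier_quotient)
    show "coset ` K \<noteq> {}" using algebra_idealD(2)[OF K] by blast
    fix X assume "X \<in> coset ` K"
    then obtain a where a: "a \<in> K" "X = coset a" by blast
    then have "\<ominus>\<^bsub>Q\<^esub> X = coset (- a)" using uminus_quotient sub by blast
    then show "inv\<^bsub>add_monoid Q\<^esub> X \<in> coset ` K"
      using algebra_ideal_uminus[OF K a(1)] by (simp add: a_inv_def)
    fix Y assume "Y \<in> coset ` K"
    then show "X \<otimes>\<^bsub>add_monoid Q\<^esub> Y \<in> coset ` K"
      using a algebra_idealD(3)[OF K] by (auto simp: add_quotient)
  qed
  moreover have "R \<otimes>\<^bsub>Q\<^esub> X \<in> coset ` K \<and> X \<otimes>\<^bsub>Q\<^esub> R \<in> coset ` K" if "X \<in> coset ` K" "R \<in> carrier Q" for X R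
  proof -
    obtain a r where a: "a \<in> K" "X = coset a" and r: "r \<in> free_carrier S" "R = coset r"
      using \<open>X \<in> coset ` K\<close> \<open>R \<in> carrier Q\<close> by (auto simp: carrier_quotient)
    then have "r * a \<in> K" "a * r \<in> K"
      using algebra_ideal_mult[OF K] free_carrier_span by blast+
    then show ?thesis
      using mult_quotient[of r a] mult_quotient[of a r] a r sub by auto
  qed
  ultimately show ?thesis
    unfolding two_sided_ideal_def by (auto intro: additive_subgroup.intro)
qed

lemma two_sided_ideal_preimage:
  assumes I: "two_sided_ideal I Q"
  shows "two_sided_ideal (preimage I) (free_algebra S)" "J \<subseteq> preimage I"
proof -
  interpret I: additive_subgroup I Q using I by (simp add: two_sided_ideal_def)
  have zero: "coset 0 \<in> I" using I.zero_closed by (simp add: zero_quotient)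
  show "J \<subseteq> preimage I"
  proof
    fix a assume "a \<in> J"
    then have "coset a = coset 0" "a \<in> free_carrier S"
      using algebra_idealD(1)[OF ideal] by (auto simp: coset_eq_iff)
    then show "a \<in> preimage I" using zero by (simp add: preimage_def)
  qed
  have "a - b \<in> preimage I" if "a \<in> preimage I" "b \<in> preimage I" for a b
    using that I.a_closed[of "coset a" "\<ominus>\<^bsub>Q\<^esub> coset b"] I.a_inv_closed[of "coset b"]
    by (auto simp: preimage_def uminus_quotient add_quotient)
  moreover have "r * a \<in> preimage I \<and> a * r \<in> preimage I" if "a \<in> preimage I" "r \<in> free_carrier S" for a r
  proof -
    have "coset r \<otimes>\<^bsub>Q\<^esub> coset a \<in> I" "coset a \<otimes>\<^bsub>Q\<^esub> coset r \<in> I"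
      using I that unfolding two_sided_ideal_def by (auto simp: preimage_def carrier_quotient)
    moreover have "r \<in> span_words S" using that(2) free_carrier_span by blast
    ultimately show ?thesis
      using that by (auto simp: preimage_def mult_quotient)
  qed
  ultimately show "two_sided_ideal (preimage I) (free_algebra S)"
    unfolding two_sided_ideal_def additive_subgroup_free_algebra_iff
    using zero by (auto simp: preimage_def)
qed

end

section \<open>Graded ideals of the graph algebra\<close>

context row_finite_graph
begin

abbreviation graph_coset ::
  "(('v, 'e) letter free_word \<Rightarrow>\<^sub>0 'k::field) \<Rightarrow> (('v, 'e) letter free_word \<Rightarrow>\<^sub>0 'k) set" where
  "graph_coset a \<equiv> graph_ideal E +>\<^bsub>free_algebra (graph_letters E)\<^esub> a"

lemma relator_ideal_graph_ideal: "relator_ideal E (graph_ideal E)"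
  unfolding graph_ideal_eq_vertex_ideal by (rule relator_ideal_vertex_ideal) simp

sublocale alg: free_quotient "graph_letters E" "graph_ideal E :: (('v, 'e) letter free_word \<Rightarrow>\<^sub>0 'k::field) set"
  by unfold_locales (rule relator_ideal.ideal[OF relator_ideal_graph_ideal])

lemma graph_algebra_eq: "graph_algebra E = alg.Q"
  by (simp add: graph_algebra_def)

lemma graph_component_iff:
  "X \<in> graph_algebra_component E n \<longleftrightarrow>
     (\<exists>a. X = graph_coset a \<and> a \<in> free_carrier (graph_letters E) \<and> homogeneous n a)"
  by (auto simp: graph_algebra_component_def homogeneous_def)

text \<open>A ring ideal is automatically closed under scalars: if \<open>u\<close> is a local unit for \<open>a\<close> then
\<open>k a = (k u) a\<close>, and \<open>k u\<close> is an element of the algebra.\<close>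

lemma two_sided_relator_ideal:
  assumes I: "two_sided_ideal I (free_algebra (graph_letters E))" and J: "graph_ideal E \<subseteq> I"
  shows "relator_ideal E (I :: (('v, 'e) letter free_word \<Rightarrow>\<^sub>0 'k::field) set)"
proof -
  interpret J: relator_ideal E "graph_ideal E :: (('v, 'e) letter free_word \<Rightarrow>\<^sub>0 'k) set"
    by (rule relator_ideal_graph_ideal)
  have sub: "I \<subseteq> free_carrier J.L" and diff: "\<And>a b. a \<in> I \<Longrightarrow> b \<in> I \<Longrightarrow> a - b \<in> I"
    using I by (auto simp: two_sided_ideal_def additive_subgroup_free_algebra_iff)
  have "scalar c * a \<in> I" if a: "a \<in> I" for c a
  proof -
    have aL: "a \<in> free_carrier J.L" using a sub by blast
    define u where "u = (\<Sum>v\<in>(\<lambda>w. letter_source (hd (letters w))) ` Poly_Mapping.keys a. J.p v)"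
    have u: "u \<in> free_carrier J.L"
      using J.local_unit(2)[OF aL] unfolding u_def by (intro free_carrier_sum) auto
    have "u * a - a \<in> graph_ideal E"
      using J.local_unit(3)[OF aL] by (simp add: J.cong_def u_def)
    then have "scalar c * (u * a - a) \<in> I"
      using algebra_idealD(4)[OF J.ideal] J by blast
    moreover have "(scalar c * u) * a \<in> I"
      using I a u by (auto simp: two_sided_ideal_def)
    ultimately show ?thesis
      using diff[of "(scalar c * u) * a" "scalar c * (u * a - a)"] by (simp add: algebra_simps)
  qed
  then have "algebra_ideal (graph_letters E) I"
    using I algebra_ideal_iff[of I "graph_letters E"] by simp
  then show ?thesis using J J.relators by unfold_locales auto
qed

text \<open>The components of a coset are the cosets of the homogeneous components of a representative. They
are unique because the ideal of relations is itself graded: if homogeneous representatives add up to \<open>a\<close>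
modulo the relations, then they agree with the components of \<open>a\<close> modulo the relations.\<close>

lemma graded_ideal_image:
  fixes K :: "(('v, 'e) letter free_word \<Rightarrow>\<^sub>0 'k::field) set"
  assumes K: "relator_ideal E K" and graded: "graded_set K" and JK: "graph_ideal E \<subseteq> K"
  shows "graph_coset ` K \<in> graded_ideals (graph_algebra E) (graph_algebra_component E)"
proof -
  let ?J = "graph_ideal E :: (('v, 'e) letter free_word \<Rightarrow>\<^sub>0 'k) set"
  let ?R = "graph_algebra E :: ('k, (('v, 'e) letter free_word \<Rightarrow>\<^sub>0 'k) set) module"
  let ?I = "graph_coset ` K" and ?V = "graph_algebra_component E :: int \<Rightarrow> (('v, 'e) letter free_word \<Rightarrow>\<^sub>0 'k) set set"
  interpret K: relator_ideal E K by fact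
  have sub: "K \<subseteq> free_carrier (graph_letters E)" using algebra_idealD(1)[OF K.ideal] .
  have gJ: "graded_set ?J"
    unfolding graph_ideal_eq_vertex_ideal by (rule graded_vertex_ideal) simp
  have two: "two_sided_ideal ?I ?R"
    unfolding graph_algebra_eq by (rule alg.two_sided_ideal_image[OF K.ideal JK])
  have choose: "\<exists>b. (\<forall>n. b n \<in> K \<and> homogeneous n (b n) \<and> c n = graph_coset (b n)) \<and>
      finsum ?R c {n. c n \<noteq> \<zero>\<^bsub>?R\<^esub>} = graph_coset (\<Sum>n\<in>{n. c n \<noteq> \<zero>\<^bsub>?R\<^esub>}. b n)"
    if c: "finite_support_family ?R (\<lambda>n. ?I \<inter> ?V n) c" for c
  proof -
    have "\<exists>b. b \<in> K \<and> homogeneous n b \<and> c n = graph_coset b" for n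
    proof -
      have "c n \<in> ?I" "c n \<in> ?V n" using c by (auto simp: finite_support_family_def)
      then obtain b where "c n = graph_coset b" "homogeneous n b" "graph_coset b \<in> ?I"
        unfolding graph_component_iff by metis
      then show ?thesis
        using alg.coset_image_iff[OF K.ideal JK, of b] by blast
    qed
    then obtain b where b: "\<And>n. b n \<in> K \<and> homogeneous n (b n) \<and> c n = graph_coset (b n)" by metis
    then have "c = (\<lambda>n. graph_coset (b n))" by auto
    then have "finsum ?R c F = graph_coset (sum b F)" if "finite F" for F
      using alg.finsum_quotient[OF that, of b] b sub by (auto simp: graph_algebra_eq)
    then show ?thesis using b c by (auto simp: finite_support_family_def)
  qed
  have "is_direct_sum ?R ?I (\<lambda>n. ?I \<inter> ?V n)"
    unfolding is_direct_sum_def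
  proof (intro conjI allI impI ballI)
    fix c assume "finite_support_family ?R (\<lambda>n. ?I \<inter> ?V n) c"
    from choose[OF this] obtain b where "\<And>n. b n \<in> K"
      and "finsum ?R c {n. c n \<noteq> \<zero>\<^bsub>?R\<^esub>} = graph_coset (\<Sum>n\<in>{n. c n \<noteq> \<zero>\<^bsub>?R\<^esub>}. b n)"
      by blast
    then show "finsum ?R c {n. c n \<noteq> \<zero>\<^bsub>?R\<^esub>} \<in> ?I"
      by (simp only:) (intro imageI algebra_ideal_sum[OF K.ideal])
  next
    fix X assume "X \<in> ?I"
    then obtain a where a: "a \<in> K" "X = graph_coset a" by blast
    let ?c = "\<lambda>n. graph_coset (homogeneous_part n a)"
    have part: "homogeneous_part n a \<in> K" for n using graded a(1) by (simp add: graded_set_def)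
    have zero: "?c n = \<zero>\<^bsub>?R\<^esub> \<longleftrightarrow> homogeneous_part n a \<in> ?J" for n
      by (simp add: graph_algebra_eq alg.zero_quotient alg.coset_eq_iff)
    have J0: "0 \<in> ?J" using algebra_idealD(2)[OF alg.ideal] .
    let ?N = "{n. ?c n \<noteq> \<zero>\<^bsub>?R\<^esub>}"
    have fin: "finite ?N"
      by (rule finite_subset[OF _ finite_homogeneous_parts[of a]]) (use zero J0 in auto)
    have family: "finite_support_family ?R (\<lambda>n. ?I \<inter> ?V n) ?c"
      unfolding finite_support_family_def
      using part sub fin homogeneous_homogeneous_part[of _ a] by (auto simp: graph_component_iff)
    \<comment> \<open>Nonzero components may still vanish in the quotient; dropping them changes the sum by a relation.\<close>
    have "a - (\<Sum>n\<in>?N. homogeneous_part n a) = (\<Sum>n\<in>{n. homogeneous_part n a \<noteq> 0} - ?N. homogeneous_part n a)"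
    proof -
      have "?N \<subseteq> {n. homogeneous_part n a \<noteq> 0}" using zero J0 by auto
      then show ?thesis
        using sum_diff[OF finite_homogeneous_parts[of a], of ?N "\<lambda>n. homogeneous_part n a"]
          sum_homogeneous_parts[OF finite_homogeneous_parts[of a], of a] by simp
    qed
    also have "\<dots> \<in> ?J"
      using zero by (intro algebra_ideal_sum[OF alg.ideal]) auto
    finally have X: "X = graph_coset (\<Sum>n\<in>?N. homogeneous_part n a)"
      by (simp add: a(2) alg.coset_eq_iff)
    have "finsum ?R ?c ?N = graph_coset (\<Sum>n\<in>?N. homogeneous_part n a)"
      unfolding graph_algebra_eq by (rule alg.finsum_quotient) (use fin part sub in \<open>auto simp: graph_algebra_eq\<close>)
    then have sum: "X = finsum ?R ?c ?N"
      using X by (simp only:)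
    have unique: "c = ?c"
      if c: "finite_support_family ?R (\<lambda>n. ?I \<inter> ?V n) c" "X = finsum ?R c {n. c n \<noteq> \<zero>\<^bsub>?R\<^esub>}" for c
    proof
      fix n
      let ?M = "{n. c n \<noteq> \<zero>\<^bsub>?R\<^esub>}"
      obtain b where b: "\<And>n. b n \<in> K" "\<And>n. homogeneous n (b n)" "\<And>n. c n = graph_coset (b n)"
        and "finsum ?R c ?M = graph_coset (\<Sum>n\<in>?M. b n)"
        using choose[OF c(1)] by blast
      then have "a - (\<Sum>n\<in>?M. b n) \<in> ?J" using c(2) a(2) by (simp add: alg.coset_eq_iff)
      then have 1: "homogeneous_part n (a - (\<Sum>n\<in>?M. b n)) \<in> ?J"
        using gJ by (simp add: graded_set_def)
      have "finite ?M" using c(1) by (simp add: finite_support_family_def)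
      then have "homogeneous_part n (\<Sum>n\<in>?M. b n) = (if n \<in> ?M then b n else 0)"
        by (simp add: homogeneous_part_sum homogeneous_part_homogeneous[OF b(2)])
      moreover have "b n \<in> ?J" if "n \<notin> ?M"
        using that b(3)[of n] by (simp add: graph_algebra_eq alg.zero_quotient alg.coset_eq_iff)
      ultimately have "homogeneous_part n a - b n \<in> ?J"
        using 1 algebra_ideal_diff[OF alg.ideal] by (cases "n \<in> ?M") (auto simp: homogeneous_part_diff)
      then have "graph_coset (homogeneous_part n a) = graph_coset (b n)"
        by (simp add: alg.coset_eq_iff)
      then show "c n = graph_coset (homogeneous_part n a)" using b(3) by simp
    qed
    show "\<exists>!c. finite_support_family ?R (\<lambda>n. ?I \<inter> ?V n) c \<and> X = finsum ?R c {n. c n \<noteq> \<zero>\<^bsub>?R\<^esub>}"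
      by (rule ex1I[of _ ?c], rule conjI[OF family sum], elim conjE, rule unique)
  qed
  then show ?thesis using two by (simp add: graded_ideals_def)
qed

text \<open>Conversely, the components of a coset have homogeneous representatives in the preimage, and these
differ from the components of a given representative by relations.\<close>

lemma graded_ideal_preimage:
  fixes I :: "(('v, 'e) letter free_word \<Rightarrow>\<^sub>0 'k::field) set set"
  assumes "I \<in> graded_ideals (graph_algebra E) (graph_algebra_component E)"
  shows "relator_ideal E (alg.preimage I)" "graded_set (alg.preimage I)" "graph_coset ` alg.preimage I = I"
proof -
  let ?J = "graph_ideal E :: (('v, 'e) letter free_word \<Rightarrow>\<^sub>0 'k) set"
  let ?R = "graph_algebra E :: ('k, (('v, 'e) letter free_word \<Rightarrow>\<^sub>0 'k) set) module"
  let ?V = "graph_algebra_component E :: int \<Rightarrow> (('v, 'e) letter free_word \<Rightarrow>\<^sub>0 'k) set set"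
  have two: "two_sided_ideal I ?R" and sum: "is_direct_sum ?R I (\<lambda>n. I \<inter> ?V n)"
    using assms by (auto simp: graded_ideals_def)
  note pre = alg.two_sided_ideal_preimage[OF two[unfolded graph_algebra_eq]]
  show rel: "relator_ideal E (alg.preimage I)"
    using pre by (rule two_sided_relator_ideal)
  show "graph_coset ` alg.preimage I = I"
    using two additive_subgroup.a_subset[of I ?R]
    by (intro alg.image_preimage) (simp add: two_sided_ideal_def graph_algebra_eq)
  show "graded_set (alg.preimage I)"
    unfolding graded_set_def
  proof (intro ballI allI)
    fix a n assume a: "a \<in> alg.preimage I"
    then have "graph_coset a \<in> I" by (simp add: alg.preimage_def)
    then obtain c where c: "finite_support_family ?R (\<lambda>n. I \<inter> ?V n) c"
      "graph_coset a = finsum ?R c {n. c n \<noteq> \<zero>\<^bsub>?R\<^esub>}"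
      using sum unfolding is_direct_sum_def by metis
    let ?M = "{n. c n \<noteq> \<zero>\<^bsub>?R\<^esub>}"
    have "\<exists>b. b \<in> free_carrier (graph_letters E) \<and> homogeneous n b \<and> c n = graph_coset b" for n
      using c(1) by (auto simp: finite_support_family_def graph_component_iff)
    then obtain b where b: "\<And>n. b n \<in> free_carrier (graph_letters E)" "\<And>n. homogeneous n (b n)"
      "\<And>n. c n = graph_coset (b n)" by metis
    have bI: "b n \<in> alg.preimage I" for n
    proof -
      have "c n \<in> I" using c(1) by (simp add: finite_support_family_def)
      then show ?thesis using b(1)[of n] unfolding b(3)[of n] alg.preimage_def by blast
    qed
    have fin: "finite ?M" using c(1) by (simp add: finite_support_family_def)
    have "c = (\<lambda>n. graph_coset (b n))" using b(3) by auto
    then have "finsum ?R c ?M = graph_coset (\<Sum>n\<in>?M. b n)"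
      using alg.finsum_quotient[OF fin, of b] b(1) by (simp add: graph_algebra_eq)
    then have "a - (\<Sum>n\<in>?M. b n) \<in> ?J" using c(2) by (simp add: alg.coset_eq_iff)
    moreover have "graded_set ?J"
      unfolding graph_ideal_eq_vertex_ideal by (rule graded_vertex_ideal) simp
    ultimately have "homogeneous_part n (a - (\<Sum>n\<in>?M. b n)) \<in> ?J"
      by (simp add: graded_set_def)
    moreover have "homogeneous_part n (\<Sum>n\<in>?M. b n) = (if n \<in> ?M then b n else 0)"
      using fin by (simp add: homogeneous_part_sum homogeneous_part_homogeneous[OF b(2)])
    ultimately have "homogeneous_part n a - (if n \<in> ?M then b n else 0) \<in> alg.preimage I"
      using subsetD[OF pre(2)] by (simp only: homogeneous_part_diff)
    moreover have "(if n \<in> ?M then b n else 0) \<in> alg.preimage I"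
      using bI algebra_idealD(2)[OF relator_ideal.ideal[OF rel]] by simp
    ultimately show "homogeneous_part n a \<in> alg.preimage I"
      using algebra_idealD(3)[OF relator_ideal.ideal[OF rel]] by fastforce
  qed
qed

definition ideal_vertices :: "(('v, 'e) letter free_word \<Rightarrow>\<^sub>0 'k::field) set set \<Rightarrow> 'v set" where
  "ideal_vertices I = {v \<in> verts E. gen_p v \<in> alg.preimage I}"

text \<open>A graded ideal \<open>I\<close> and the ideal generated by its vertices contain the same vertices, so the
comparison of graded ideals gives \<open>I\<close> back.\<close>

lemma inclusion_iso_graded_ideals:
  "inclusion_iso (hereditary_saturated_sets E)
     (graded_ideals (graph_algebra E :: ('k::field, (('v, 'e) letter free_word \<Rightarrow>\<^sub>0 'k) set) module)
        (graph_algebra_component E))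
     (\<lambda>H. graph_coset ` vertex_ideal E H)"
proof (rule inclusion_isoI[where g = ideal_vertices])
  let ?G = "graded_ideals (graph_algebra E :: ('k, (('v, 'e) letter free_word \<Rightarrow>\<^sub>0 'k) set) module)
    (graph_algebra_component E)"
  let ?vi = "\<lambda>H. vertex_ideal E H :: (('v, 'e) letter free_word \<Rightarrow>\<^sub>0 'k) set"
  have HV: "H \<subseteq> verts E" if "H \<in> hereditary_saturated_sets E" for H
    using that by (auto simp: hereditary_saturated_sets_def hereditary_def)
  have mono: "?vi H \<subseteq> ?vi H'" if "H' \<subseteq> verts E" "H \<subseteq> H'" for H H'
    using that vertices_in_vertex_ideal[of _ H' E]
    by (intro vertex_ideal_least algebra_ideal_vertex_ideal relators_in_vertex_ideal) auto
  have JK: "graph_ideal E \<subseteq> ?vi H" if "H \<subseteq> verts E" for H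
    unfolding graph_ideal_eq_vertex_ideal using that by (intro mono) auto
  show "graph_coset ` ?vi H \<in> ?G" if "H \<in> hereditary_saturated_sets E" for H
    using HV[OF that] by (intro graded_ideal_image relator_ideal_vertex_ideal graded_vertex_ideal JK)
  show "ideal_vertices I \<in> hereditary_saturated_sets E" if "I \<in> ?G" for I
    using relator_ideal.hereditary_saturated_vertices[OF graded_ideal_preimage(1)[OF that]]
    by (simp add: ideal_vertices_def)
  show "ideal_vertices (graph_coset ` ?vi H) = H" if H: "H \<in> hereditary_saturated_sets E" for H
  proof -
    interpret hereditary_saturated E H
      using H by unfold_locales (auto simp: hereditary_saturated_sets_def)
    have "alg.preimage (graph_coset ` ?vi H) = ?vi H"
      by (intro alg.preimage_image algebra_ideal_vertex_ideal JK HV H)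
    then show ?thesis
      using HV[OF H] by (auto simp: ideal_vertices_def vertex_in_vertex_ideal_iff)
  qed
  show "graph_coset ` ?vi (ideal_vertices I) = I" if I: "I \<in> ?G" for I
  proof -
    note pre = graded_ideal_preimage[OF I]
    have V: "ideal_vertices I \<subseteq> verts E" by (auto simp: ideal_vertices_def)
    have "alg.preimage I \<subseteq> ?vi (ideal_vertices I)"
      by (rule graded_ideal_subset[OF pre(1,2) relator_ideal_vertex_ideal[OF V]])
         (simp add: ideal_vertices_def vertices_in_vertex_ideal)
    moreover have "?vi (ideal_vertices I) \<subseteq> alg.preimage I"
      using relator_ideal.ideal[OF pre(1)] relator_ideal.relators[OF pre(1)]
      by (intro vertex_ideal_least) (auto simp: ideal_vertices_def)
    ultimately show ?thesis using pre(3) by simp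
  qed
  show "graph_coset ` ?vi H \<subseteq> graph_coset ` ?vi H'"
    if "H \<in> hereditary_saturated_sets E" "H' \<in> hereditary_saturated_sets E" "H \<subseteq> H'" for H H'
    using mono[OF HV[OF that(2)] that(3)] by (rule image_mono)
  show "ideal_vertices I \<subseteq> ideal_vertices I'" if "I \<subseteq> I'" for I I' :: "(('v, 'e) letter free_word \<Rightarrow>\<^sub>0 'k) set set"
    using that by (auto simp: ideal_vertices_def alg.preimage_def)
qed

end

section \<open>The three lattices\<close>

theorem theorem5p3:
  fixes E :: "('v, 'e) pre_digraph"
  assumes "wf_digraph E" and "row_finite E"
  shows "(\<exists>f. inclusion_iso (hereditary_saturated_sets E) (order_ideals (graph_monoid E)) f) \<and>
    (\<exists>g. inclusion_iso (order_ideals (graph_monoid E))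
       (graded_ideals
          (graph_algebra E :: ('k::field, (('v, 'e) letter free_word \<Rightarrow>\<^sub>0 'k) set) module)
          (graph_algebra_component E)) g)"
proof -
  have "row_finite_graph E"
    using assms by (intro row_finite_graph.intro row_finite_graph_axioms.intro)
  from row_finite_graph.inclusion_iso_graded_ideals[OF this] inclusion_iso_vertex_order_ideal[OF assms]
  show ?thesis by (blast intro: inclusion_iso_inv_comp)
qed

end
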